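(* Let $m,n\ge 1$ be integers. The down-degree statistic on the $m$-Tamari lattice $\mathrm{Tam}_n(m)$ is homomesic for rowmotion with average $\frac{m(n-1)}{m+1}$; that is, for every orbit $\mathcal O$ of $\mathrm{Row}\colon\mathrm{Tam}_n(m)\to\mathrm{Tam}_n(m)$, \[\frac{1}{|\mathcal O|}\sum_{\mathsf b\in\mathcal O}\mathrm{ddeg}(\mathsf b)=\frac{m(n-1)}{m+1},\] where $\mathrm{ddeg}(\mathsf b)$ is the number of elements of $\mathrm{Tam}_n(m)$ covered by $\mathsf b$.
   Context: Intervals are integer intervals: $[a,b]=\{a,\dots,b\}$ (empty if $a>b$), $[b]=[1,b]$. Vectors are indexed from $0$. $m$-Tamari lattice. Let $\ell=(m+1)n$. $\mathrm{Tam}_n(m)$ is the set of integer vectors $\mathsf b=(\mathsf b_0,\dots,\mathsf b_\ell)$ such that (I) $\mathsf b_{(m+1)k}=k$ for all $k\in[0,n]$; (II) $s+1\le \mathsf b_{(m+1)s+t}\le n$ for all $s\in[0,n-1]$, $t\in[m+1]$; (III) if $\mathsf b_i=k$, then $\mathsf b_j\le k$ for all $j\in[i+1,(m+1)k]$. It is ordered componentwise; it is a finite semidistributive lattice whose meet is the componentwise minimum. Rowmotion on a finite semidistributive lattice. A lattice $L$ is semidistributive if for all $x,y,z\in L$: $x\vee y=x\vee z$ implies $x\vee(y\wedge z)=x\vee y$, and $x\wedge y=x\wedge z$ implies $x\wedge(y\vee z)=x\wedge y$. Let $L$ be a finite semidistributive lattice. An element $j$ is join-irreducible if it covers exactly one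 element, denoted $j_*$; for such $j$, the set $\{z\in L:z\wedge j=j_*\}$ has a maximum, denoted $\kappa(j)$. For each cover relation $x\lessdot y$ there is a unique join-irreducible $j_{xy}$ with $j_{xy}\le y$ and $\kappa(j_{xy})\ge x$. Put $\mathcal D(z)=\{j_{xz}:x\lessdot z\}$ and $\mathcal U(z)=\{j_{zy}:z\lessdot y\}$. For each $x\in L$ there is a unique element $\mathrm{Row}(x)\in L$ with $\mathcal U(\mathrm{Row}(x))=\mathcal D(x)$; this defines a bijection $\mathrm{Row}\colon L\to L$. *)

theory Defs
  imports Complex_Main "HOL-Algebra.Lattice" "HOL-Combinatorics.Orbits"
begin

section \<open>Rowmotion on a finite semidistributive lattice\<close>

text \<open>
  The definite descriptions below denote whenever \<^term>\<open>L\<close> is a finite semidistributive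
  lattice. They are stated without that premise so that they can be applied to a concrete
  lattice directly; on other orders their values carry no meaning.
\<close>

definition covers :: "('a, 'b) gorder_scheme \<Rightarrow> 'a \<Rightarrow> 'a \<Rightarrow> bool"
    (\<open>(_ \<lessdot>\<index> _)\<close> [51, 51] 50) where
  "x \<lessdot>\<^bsub>L\<^esub> y \<longleftrightarrow> x \<in> carrier L \<and> y \<in> carrier L \<and> x \<sqsubset>\<^bsub>L\<^esub> y \<and>
     \<not> (\<exists>z\<in>carrier L. x \<sqsubset>\<^bsub>L\<^esub> z \<and> z \<sqsubset>\<^bsub>L\<^esub> y)"

definition ddeg :: "('a, 'b) gorder_scheme \<Rightarrow> 'a \<Rightarrow> nat" where
  "ddeg L y = card {x. x \<lessdot>\<^bsub>L\<^esub> y}"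

definition join_irreducible :: "('a, 'b) gorder_scheme \<Rightarrow> 'a \<Rightarrow> bool" where
  "join_irreducible L j \<longleftrightarrow> j \<in> carrier L \<and> (\<exists>!x. x \<lessdot>\<^bsub>L\<^esub> j)"

definition lower_cover :: "('a, 'b) gorder_scheme \<Rightarrow> 'a \<Rightarrow> 'a" where
  "lower_cover L j = (THE x. x \<lessdot>\<^bsub>L\<^esub> j)"

definition kappa :: "('a, 'b) gorder_scheme \<Rightarrow> 'a \<Rightarrow> 'a" where
  "kappa L j = (THE g. greatest L g {z \<in> carrier L. z \<sqinter>\<^bsub>L\<^esub> j = lower_cover L j})"

text \<open>The label \<open>j\<^bsub>xy\<^esub>\<close> of a cover relation \<open>x \<lessdot> y\<close>.\<close>

definition cover_label :: "('a, 'b) gorder_scheme \<Rightarrow> 'a \<Rightarrow> 'a \<Rightarrow> 'a" where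
  "cover_label L x y =
     (THE j. join_irreducible L j \<and> j \<sqsubseteq>\<^bsub>L\<^esub> y \<and> x \<sqsubseteq>\<^bsub>L\<^esub> kappa L j)"

definition down_labels :: "('a, 'b) gorder_scheme \<Rightarrow> 'a \<Rightarrow> 'a set" where
  "down_labels L z = {cover_label L x z | x. x \<lessdot>\<^bsub>L\<^esub> z}"

definition up_labels :: "('a, 'b) gorder_scheme \<Rightarrow> 'a \<Rightarrow> 'a set" where
  "up_labels L z = {cover_label L z y | y. z \<lessdot>\<^bsub>L\<^esub> y}"

definition row :: "('a, 'b) gorder_scheme \<Rightarrow> 'a \<Rightarrow> 'a" where
  "row L x = (THE y. y \<in> carrier L \<and> up_labels L y = down_labels L x)"

text \<open>
  \<^const>\<open>orbit\<close> collects the iterates \<open>(f ^^ k) x\<close> with \<open>k > 0\<close>; since \<open>f\<close> is meant to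
  restrict to a bijection of the finite set \<open>A\<close>, this is the usual orbit and contains \<open>x\<close>.
\<close>

definition homomesic :: "'a set \<Rightarrow> ('a \<Rightarrow> 'a) \<Rightarrow> ('a \<Rightarrow> real) \<Rightarrow> real \<Rightarrow> bool" where
  "homomesic A f stat c \<longleftrightarrow>
     (\<forall>Orb \<in> orbit f ` A. 1 / real (card Orb) * (\<Sum>x\<in>Orb. stat x) = c)"


section \<open>The \<open>m\<close>-Tamari lattice\<close>

text \<open>
  A vector \<open>(b\<^sub>0, \<dots>, b\<^sub>l)\<close> with \<open>l = (m + 1) n\<close> is a list of length \<open>l + 1\<close>.
  In the last condition the upper bound \<open>(m + 1) b\<^sub>i\<close> on \<open>j\<close> is at most \<open>l\<close> by the
  first two conditions, so \<open>b ! j\<close> is always a genuine entry.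
\<close>

definition tamari_vectors :: "nat \<Rightarrow> nat \<Rightarrow> int list set" where
  "tamari_vectors m n = {b. length b = (m + 1) * n + 1 \<and>
     (\<forall>k\<in>{0..n}. b ! ((m + 1) * k) = int k) \<and>
     (\<forall>s<n. \<forall>t\<in>{1..m + 1}. int s + 1 \<le> b ! ((m + 1) * s + t) \<and> b ! ((m + 1) * s + t) \<le> int n) \<and>
     (\<forall>i\<in>{0..(m + 1) * n}. \<forall>j. i + 1 \<le> j \<and> int j \<le> int (m + 1) * b ! i \<longrightarrow> b ! j \<le> b ! i)}"

definition Tam :: "nat \<Rightarrow> nat \<Rightarrow> int list gorder" where
  "Tam m n = \<lparr>carrier = tamari_vectors m n, eq = (=), le = list_all2 (\<le>)\<rparr>"

end

theory Submission
  imports Defs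
begin

text \<open>
  Put \<open>N = m + 1\<close> and read a bracket vector \<open>x\<close> as a noncrossing partition of \<open>1, \<dots>, N n\<close>, two
  positions being in the same block if \<open>x\<close> has the same value there; the block maxima are then
  the multiples of \<open>N\<close>. The elements covered by \<open>x\<close> are labelled by the pairs \<open>(p, w)\<close> such that
  \<open>p\<close> is the predecessor of \<open>N w + 1\<close> in its block, the elements covering \<open>x\<close> by the pairs
  \<open>(p, w)\<close> such that \<open>p < N w\<close> are the minimum and the maximum of a block and \<open>w < n\<close>. Rowmotion
  turns the first kind of pair into the second.

  Let \<open>A r\<close> count the block minima other than \<open>1\<close> that are congruent to \<open>r\<close> modulo \<open>N\<close>. If
  \<open>N\<close> does not divide \<open>p\<close>, then \<open>p + 1\<close> is a block minimum exactly if the successor of \<open>p\<close> in its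
  block is \<open>N w + 1\<close> for some \<open>w\<close>. Hence rowmotion rotates the residues,
  \<open>A r (Row x) = A (r + 1) x\<close>, so all \<open>A r\<close> have the same average over an orbit. Since the \<open>A r\<close>
  add up to \<open>n - 1\<close> and the down-degree is \<open>n - 1 - A 1\<close>, the average follows.
\<close>

lemma first_occurrence:
  fixes x :: "nat \<Rightarrow> 'a"
  assumes "x i = v"
  obtains p where "x p = v" "p \<le> i" "\<And>j. j < p \<Longrightarrow> x j \<noteq> v"
proof (rule that)
  show "x (LEAST p. x p = v) = v" by (rule LeastI[of _ i]) (rule assms)
  show "(LEAST p. x p = v) \<le> i" by (rule Least_le) (rule assms)
  show "x j \<noteq> v" if "j < (LEAST p. x p = v)" for j using not_less_Least[OF that] .
qed

section \<open>Bracket vectors\<close>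

locale m_tamari =
  fixes m n N :: nat
  assumes m_pos: "1 \<le> m" and n_pos: "1 \<le> n" and N_eq: "N = m + 1"
begin

text \<open>The value \<open>0\<close> beyond \<open>N n\<close> makes the encoding by functions unique.\<close>

definition brackets :: "(nat \<Rightarrow> nat) set" where
  "brackets = {x. (\<forall>k\<le>n. x (N * k) = k) \<and> (\<forall>i\<le>N * n. i \<le> N * x i \<and> x i \<le> n) \<and>
     (\<forall>i j. i < j \<and> j \<le> N * x i \<longrightarrow> x j \<le> x i) \<and> (\<forall>i>N * n. x i = 0)}"

definition vec :: "(nat \<Rightarrow> nat) \<Rightarrow> int list" where
  "vec x = map (\<lambda>i. int (x i)) [0..<N * n + 1]"

definition down_arcs :: "(nat \<Rightarrow> nat) \<Rightarrow> (nat \<times> nat) set" where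
  "down_arcs x = {(p, w). 1 \<le> p \<and> p \<le> N * w \<and> w < n \<and> x p = x (N * w + 1) \<and>
     (\<forall>j. p < j \<and> j \<le> N * w \<longrightarrow> x j \<le> w)}"

definition up_arcs :: "(nat \<Rightarrow> nat) \<Rightarrow> (nat \<times> nat) set" where
  "up_arcs x = {(p, w). \<not> N dvd p \<and> x p = w \<and> w < n \<and> (\<forall>j<p. x j \<noteq> w)}"

definition arcs :: "(nat \<times> nat) set" where
  "arcs = {(p, w). \<not> N dvd p \<and> p < N * w \<and> w < n}"

lemma N_ge2: "2 \<le> N"
  using m_pos N_eq by simp

lemma mult_less_step: "w < u \<Longrightarrow> N * w + N \<le> N * u"
  by (metis Suc_leI mult_Suc_right mult_le_mono2 add.commute)

lemma mult_less_step1: "w < u \<Longrightarrow> N * w + 1 \<le> N * u"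
  using mult_less_step[of w u] N_ge2 by linarith

text \<open>Nesting need only be checked inside the vector: beyond \<open>N * n\<close> the value 0
  leaves no \<open>j\<close> to reach and lies below every bound.\<close>

lemma bracketsI:
  assumes "\<And>k. k \<le> n \<Longrightarrow> x (N * k) = k"
    and "\<And>i. i \<le> N * n \<Longrightarrow> i \<le> N * x i"
    and "\<And>i. i \<le> N * n \<Longrightarrow> x i \<le> n"
    and "\<And>i j. i < j \<Longrightarrow> j \<le> N * x i \<Longrightarrow> i \<le> N * n \<Longrightarrow> j \<le> N * n \<Longrightarrow> x j \<le> x i"
    and "\<And>i. i > N * n \<Longrightarrow> x i = 0"
  shows "x \<in> brackets"
proof -
  have "x j \<le> x i" if "i < j" "j \<le> N * x i" for i j
    using assms(4)[of i j] assms(5)[of i] assms(5)[of j] that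
    by (cases "i \<le> N * n"; cases "j \<le> N * n") auto
  then show ?thesis using assms unfolding brackets_def by auto
qed

section \<open>Elementary properties of a bracket vector\<close>

context
  fixes x assumes x: "x \<in> brackets"
begin

lemma at_mult: "k \<le> n \<Longrightarrow> x (N * k) = k"
  using x unfolding brackets_def by blast

lemma at_0: "x 0 = 0"
  using at_mult[of 0] by simp

lemma at_dvd: "N dvd i \<Longrightarrow> i \<le> N * n \<Longrightarrow> x i = i div N"
  using at_mult N_ge2 by (auto elim!: dvdE)

lemma le_mult: "i \<le> N * n \<Longrightarrow> i \<le> N * x i"
  using x unfolding brackets_def by blast

lemma outside: "i > N * n \<Longrightarrow> x i = 0"
  using x unfolding brackets_def by blast

lemma le_n: "x i \<le> n"
  using x outside[of i] unfolding brackets_def by (cases "i \<le> N * n") auto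

lemma nested: "i < j \<Longrightarrow> j \<le> N * x i \<Longrightarrow> x j \<le> x i"
  using x unfolding brackets_def by blast

lemma nested': "i \<le> j \<Longrightarrow> j \<le> N * x i \<Longrightarrow> x j \<le> x i"
  using nested by (cases "i = j") auto

lemma pos_le: "x i \<noteq> 0 \<Longrightarrow> i \<le> N * n"
  using outside by (meson linorder_not_le)

lemma le_mult': "x i = w \<Longrightarrow> w \<noteq> 0 \<Longrightarrow> i \<le> N * w"
  using le_mult pos_le by blast

lemma pos: "1 \<le> i \<Longrightarrow> i \<le> N * n \<Longrightarrow> 1 \<le> x i"
  using le_mult[of i] by (cases "x i") auto

lemma next_gt: "w < n \<Longrightarrow> w < x (N * w + 1)"
  using le_mult[of "N * w + 1"] mult_less_step1[of w n]
  by (metis add_leD1 add_le_same_cancel1 mult_le_mono2 not_less not_one_le_zero le_trans)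

text \<open>Off the multiples of \<open>N\<close> the bound \<open>i \<le> N * x i\<close> is
  strict, so \<open>i\<close> still reaches \<open>i + 1\<close>; a bracket vector can rise only
  right after a multiple of \<open>N\<close>.\<close>

lemma succ_le:
  assumes "\<not> N dvd i" "i \<le> N * n"
  shows "x (i + 1) \<le> x i"
proof -
  have "i \<noteq> N * x i" using assms(1) by (metis dvd_triv_left)
  then show ?thesis using nested[of i "i + 1"] le_mult[OF assms(2)] by simp
qed

section \<open>Down arcs and the elements below a bracket vector\<close>

lemma down_arcD:
  assumes "(p, w) \<in> down_arcs x"
  shows "\<not> N dvd p" "1 \<le> p" "p < N * w" "w < n" "w < x p" "x p = x (N * w + 1)"
    "\<And>j. p < j \<Longrightarrow> j \<le> N * w \<Longrightarrow> x j \<le> w" "p < N * n"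
proof -
  show *: "1 \<le> p" "w < n" "x p = x (N * w + 1)"
    "\<And>j. p < j \<Longrightarrow> j \<le> N * w \<Longrightarrow> x j \<le> w"
    using assms unfolding down_arcs_def by auto
  then show lt: "w < x p" using next_gt by simp
  have le: "p \<le> N * w" using assms unfolding down_arcs_def by auto
  \<comment> \<open>A multiple \<open>N * s\<close> has value \<open>s \<le> w\<close>, against
    \<open>w < x p\<close>.\<close>
  show "\<not> N dvd p"
  proof
    assume "N dvd p"
    then obtain s where s: "p = N * s" by blast
    then have "s \<le> w" using le N_ge2 by simp
    then show False using at_mult[of s] lt *(2) s by simp
  qed
  then show "p < N * w" using le by (metis dvd_triv_left le_neq_implies_less)
  then show "p < N * n" using mult_less_step1[OF *(2)] by linarith
qed

text \<open>So \<open>w\<close> is the largest value to which the entry at \<open>p\<close> can drop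
  without breaking nesting: for a larger \<open>u\<close> the interval up to \<open>N * u\<close>
  contains \<open>N * w + 1\<close>, where the value is \<open>x p\<close>, hence above
  \<open>u\<close>.\<close>

lemma down_arc_max:
  assumes "(p, w) \<in> down_arcs x" and u: "u < x p" "\<And>j. p < j \<Longrightarrow> j \<le> N * u \<Longrightarrow> x j \<le> u"
  shows "u \<le> w"
proof (rule ccontr)
  note d = down_arcD[OF assms(1)]
  assume "\<not> u \<le> w"
  then have "N * w + 1 \<le> N * u" using mult_less_step1 by simp
  then have "x (N * w + 1) \<le> u" using u(2)[of "N * w + 1"] d(3) by simp
  then show False using d(6) u(1) by simp
qed

lemma down_arc_unique:
  assumes "(p, w) \<in> down_arcs x" "(p, u) \<in> down_arcs x"
  shows "w = u"
  using down_arc_max[OF assms(1)] down_arc_max[OF assms(2)]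
    down_arcD[OF assms(1)] down_arcD[OF assms(2)] by (meson le_antisym)

text \<open>If \<open>p < q\<close>, then \<open>q\<close> lies under the arc from \<open>p\<close>,
  so \<open>x q \<le> w\<close>, against \<open>w < x q\<close>.\<close>

lemma down_arc_unique':
  assumes "(p, w) \<in> down_arcs x" "(q, w) \<in> down_arcs x"
  shows "p = q"
  using down_arcD(3,5,7)[OF assms(1)] down_arcD(3,5,7)[OF assms(2)]
  by (meson less_imp_le not_less nat_neq_iff)

lemma down_arcs_subset: "down_arcs x \<subseteq> arcs"
  using down_arcD unfolding arcs_def by auto

text \<open>At a descent the entry at \<open>p\<close> can drop to \<open>x (p + 1)\<close>. The
  largest value \<open>w\<close> to which it can drop gives the arc: were
  \<open>x (N * w + 1)\<close> below \<open>x p\<close>, it would be a larger such value.\<close>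

lemma descent_down_arc:
  assumes p: "\<not> N dvd p" "p \<le> N * n" and desc: "x (p + 1) < x p"
  obtains w where "(p, w) \<in> down_arcs x"
proof -
  define C where "C = {u. u < x p \<and> p \<le> N * u \<and> (\<forall>j. p < j \<and> j \<le> N * u \<longrightarrow> x j \<le> u)}"
  have p1: "p + 1 \<le> N * n" using p by (metis Suc_eq_plus1 Suc_leI dvd_triv_left le_neq_implies_less)
  have "x (p + 1) \<in> C"
    using desc le_mult[OF p1] nested'[of "p + 1"] unfolding C_def by auto
  moreover have fin: "finite C" unfolding C_def by simp
  ultimately have w: "Max C \<in> C" using Max_in by blast
  define w where "w = Max C"
  have w1: "w < x p" "p \<le> N * w" "\<And>j. p < j \<Longrightarrow> j \<le> N * w \<Longrightarrow> x j \<le> w"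
    using w unfolding w_def[symmetric] unfolding C_def by auto
  have wn: "w < n" using w1(1) le_n[of p] by simp
  define u where "u = x (N * w + 1)"
  have "w < u" using next_gt[OF wn] u_def by simp
  have "u \<le> x p" unfolding u_def
    using nested[of p "N * w + 1"] w1(2) mult_less_step1[OF w1(1)] by simp
  moreover have "\<not> u < x p"
  proof
    assume "u < x p"
    \<comment> \<open>Up to \<open>N * w\<close> the values are at most \<open>w\<close>; from
      \<open>N * w + 1\<close> on, nesting at that position bounds them by \<open>u\<close>.\<close>
    have "x j \<le> u" if "p < j" "j \<le> N * u" for j
    proof (cases "j \<le> N * w")
      case True
      then show ?thesis using w1(3) that \<open>w < u\<close> by fastforce
    next
      case False
      then show ?thesis using nested'[of "N * w + 1" j] that u_def by simp
    qed
    then have "u \<in> C" using \<open>u < x p\<close> w1(2) mult_less_step1[OF \<open>w < u\<close>] unfolding C_def by auto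
    then show False using Max_ge[OF fin] \<open>w < u\<close> w_def by (meson leD)
  qed
  ultimately have "x p = u" by simp
  moreover have "1 \<le> p" using p by (cases p) auto
  ultimately have "(p, w) \<in> down_arcs x" using w1 wn u_def unfolding down_arcs_def by auto
  then show ?thesis using that by blast
qed

text \<open>Lowering at \<open>p\<close> can break nesting only for \<open>i = p\<close>, and there
  the arc condition is what the new value demands.\<close>

lemma lower_in_brackets:
  assumes "(p, w) \<in> down_arcs x"
  shows "x(p := w) \<in> brackets"
proof (rule bracketsI)
  note d = down_arcD[OF assms]
  show "(x(p := w)) (N * k) = k" if "k \<le> n" for k
    using d(1) at_mult that by auto
  show "i \<le> N * (x(p := w)) i" if "i \<le> N * n" for i
    using d(3) le_mult that by auto
  show "(x(p := w)) i \<le> n" for i using d(4) le_n by auto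
  show "(x(p := w)) i = 0" if "i > N * n" for i using d(8) outside that by auto
  show "(x(p := w)) j \<le> (x(p := w)) i" if "i < j" "j \<le> N * (x(p := w)) i" for i j
    using that d(5,7) nested[of i j] by (auto split: if_splits)
qed

text \<open>Let \<open>p\<close> be the last position where \<open>c\<close> and \<open>x\<close>
  differ. To its right they agree, so nesting of \<open>c\<close> makes \<open>p\<close> a descent
  of \<open>x\<close> and \<open>c p\<close> a value to which \<open>x\<close> can drop there; by
  maximality \<open>c p \<le> w\<close>.\<close>

lemma below_some_lower:
  assumes c: "c \<in> brackets" "c \<le> x" "c \<noteq> x"
  obtains p w where "(p, w) \<in> down_arcs x" "c \<le> x(p := w)"
proof -
  define S where "S = {i. c i < x i}"
  have "S \<subseteq> {..N * n}"
  proof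
    fix i assume "i \<in> S"
    then have "x i \<noteq> 0" unfolding S_def by simp
    then show "i \<in> {..N * n}" using pos_le by simp
  qed
  then have fin: "finite S" by (rule finite_subset) simp
  obtain i where "c i \<noteq> x i" using c(3) by auto
  then have "i \<in> S" using c(2) unfolding S_def le_fun_def by (simp add: le_neq_implies_less)
  then have "S \<noteq> {}" by blast
  define p where "p = Max S"
  have "p \<in> S" using p_def fin \<open>S \<noteq> {}\<close> by simp
  then have p: "c p < x p" unfolding S_def by simp
  have above: "c j = x j" if "p < j" for j
  proof -
    have "j \<notin> S" using Max_ge[OF fin, of j] that p_def by auto
    then have "x j \<le> c j" unfolding S_def by simp
    moreover have "c j \<le> x j" using c(2) by (simp add: le_fun_def)
    ultimately show ?thesis by simp
  qed
  have pn: "p \<le> N * n" using \<open>p \<in> S\<close> \<open>S \<subseteq> _\<close> by auto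
  \<comment> \<open>All bracket vectors agree at the multiples of \<open>N\<close>.\<close>
  have nd: "\<not> N dvd p"
    using p m_tamari.at_dvd[OF m_tamari_axioms c(1) _ pn] at_dvd[OF _ pn] by auto
  have "x (p + 1) < x p"
    using above[of "p + 1"] m_tamari.succ_le[OF m_tamari_axioms c(1) nd pn] p by simp
  then obtain w where w: "(p, w) \<in> down_arcs x" using descent_down_arc nd pn by blast
  have "x j \<le> c p" if "p < j" "j \<le> N * c p" for j
    using above[OF that(1)] m_tamari.nested[OF m_tamari_axioms c(1)] that by metis
  then have "c p \<le> w" using down_arc_max[OF w] p by blast
  then have "c \<le> x(p := w)" using c(2) by (auto simp: le_fun_def)
  then show ?thesis using that w by blast
qed

end

section \<open>Join-irreducible elements and their images under kappa\<close>

text \<open>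
  The join-irreducible element with label \<open>(p, w)\<close> and its image under \<open>\<kappa>\<close>; the minimal value at
  position \<open>i\<close> is \<open>(i + m) div N\<close>, the ceiling of \<open>i / N\<close>.
\<close>

definition join_irr :: "nat \<Rightarrow> nat \<Rightarrow> nat \<Rightarrow> nat" where
  "join_irr p w i = (if i > N * n then 0 else if N * (p div N) < i \<and> i \<le> p then w + 1 else (i + m) div N)"

definition kap :: "nat \<Rightarrow> nat \<Rightarrow> nat \<Rightarrow> nat" where
  "kap p w i = (if i > N * n then 0 else if N dvd i then i div N
     else if p \<le> i \<and> i \<le> N * w then w else n)"

lemma ceil_le_iff: "(i + m) div N \<le> k \<longleftrightarrow> i \<le> N * k"
proof -
  have "(i + m) div N \<le> k \<longleftrightarrow> (i + m) div N < k + 1" by linarith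
  also have "\<dots> \<longleftrightarrow> i + m < (k + 1) * N"
    using N_ge2 by (subst div_less_iff_less_mult) auto
  also have "(k + 1) * N = N * k + m + 1" using N_eq by simp
  finally show ?thesis by linarith
qed

lemma ceil_le: "x \<in> brackets \<Longrightarrow> i \<le> N * n \<Longrightarrow> (i + m) div N \<le> x i"
  using le_mult ceil_le_iff by simp

lemma ceil_mult: "(N * k + m) div N = k"
proof -
  have "m < N" using N_eq by simp
  then show ?thesis by simp
qed

lemma ceil_mult_Suc: "(N * k + 1 + m) div N = k + 1"
proof -
  have "N * k + 1 + m = N * (k + 1)" using N_eq by simp
  moreover have "N * (k + 1) div N = k + 1"
    using N_ge2 by (intro nonzero_mult_div_cancel_left) simp
  ultimately show ?thesis by (simp only:)
qed

context
  fixes p w assumes arc: "(p, w) \<in> arcs"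
begin

lemma arcD: "\<not> N dvd p" "p < N * w" "w < n" "p < N * n"
  using arc mult_less_step1[of w n] unfolding arcs_def by auto

lemma mult_not_in_column: "\<not> (N * (p div N) < N * k \<and> N * k \<le> p)"
proof
  assume a: "N * (p div N) < N * k \<and> N * k \<le> p"
  then have "p div N < k" by simp
  moreover have "k \<le> p div N" using a N_ge2
    by (metis div_le_mono nonzero_mult_div_cancel_left not_numeral_le_zero)
  ultimately show False by simp
qed

text \<open>The multiple of \<open>N\<close> following \<open>N * (p div N)\<close> already lies
  beyond \<open>p\<close>.\<close>

lemma column_le:
  assumes "N * (p div N) < i" "i \<le> N * k"
  shows "p \<le> N * k"
proof -
  have "N * (p div N) < N * k" using assms by linarith
  then have "N * (p div N) + N \<le> N * k" using mult_less_step by simp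
  moreover have "p < N * (p div N) + N"
    using N_ge2 by (metis add.commute dividend_less_times_div not_numeral_le_zero zero_less_iff_neq_zero)
  ultimately show ?thesis by linarith
qed

lemma p_in_column: "N * (p div N) < p"
  using arcD(1) by (metis dvd_triv_left le_neq_implies_less times_div_less_eq_dividend)

lemma join_irr_p: "join_irr p w p = w + 1"
  using arcD p_in_column unfolding join_irr_def by simp

lemma join_irr_in_brackets: "join_irr p w \<in> brackets"
proof (rule bracketsI)
  show "join_irr p w (N * k) = k" if "k \<le> n" for k
    using mult_not_in_column ceil_mult that unfolding join_irr_def by auto
  show "i \<le> N * join_irr p w i" if "i \<le> N * n" for i
    using arcD(2) ceil_le_iff[of i "(i + m) div N"] that unfolding join_irr_def by auto
  show "join_irr p w i \<le> n" if "i \<le> N * n" for i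
    using arcD(3) ceil_le_iff that unfolding join_irr_def by auto
  show "join_irr p w i = 0" if "i > N * n" for i
    using that unfolding join_irr_def by auto
  fix i j
  assume ij: "i < j" "j \<le> N * join_irr p w i" "i \<le> N * n" "j \<le> N * n"
  show "join_irr p w j \<le> join_irr p w i"
  proof (cases "N * (p div N) < j \<and> j \<le> p")
    case True
    show ?thesis
    proof (cases "N * (p div N) < i")
      \<comment> \<open>Left of the column the value is a ceiling, so it reaches at most
        \<open>N * (p div N)\<close> and misses \<open>j\<close>.\<close>
      case False
      then have "join_irr p w i \<le> p div N"
        using ceil_le_iff ij unfolding join_irr_def by auto
      then have "N * join_irr p w i \<le> N * (p div N)" by simp
      then have "j \<le> N * (p div N)" using ij(2) by linarith
      then show ?thesis using True by simp
    qed (use True ij in \<open>auto simp: join_irr_def\<close>)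
  next
    case False
    then have "join_irr p w j = (j + m) div N" using ij unfolding join_irr_def by auto
    then show ?thesis using ceil_le_iff ij(2) by simp
  qed
qed

lemma kap_in_brackets: "kap p w \<in> brackets"
proof (rule bracketsI)
  show "kap p w (N * k) = k" if "k \<le> n" for k
    using that N_ge2 unfolding kap_def by auto
  show "i \<le> N * kap p w i" if "i \<le> N * n" for i
    using that unfolding kap_def by auto
  show k: "kap p w i \<le> n" if "i \<le> N * n" for i
    using arcD(3) that N_ge2 unfolding kap_def by (auto elim!: dvdE)
  show "kap p w i = 0" if "i > N * n" for i
    using that unfolding kap_def by auto
  fix i j
  assume ij: "i < j" "j \<le> N * kap p w i" "i \<le> N * n" "j \<le> N * n"
  show "kap p w j \<le> kap p w i"
  proof (cases "N dvd i")
    case True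
    then show ?thesis using ij unfolding kap_def by auto
  next
    case False
    show ?thesis
    proof (cases "p \<le> i \<and> i \<le> N * w")
      case True
      then have "kap p w i = w" using False ij unfolding kap_def by auto
      then show ?thesis using ij True N_ge2 unfolding kap_def by (auto elim!: dvdE)
    next
      case 2: False
      then have "kap p w i = n" using False ij unfolding kap_def by auto
      then show ?thesis using k ij by simp
    qed
  qed
qed

text \<open>Every position \<open>i\<close> of the column reaches \<open>p\<close>, so nesting gives
  \<open>z p \<le> z i\<close>: a value above \<open>w\<close> at \<open>p\<close> forces at least
  \<open>w + 1\<close> on the whole column. Hence \<open>join_irr p w\<close> is the least bracket
  vector exceeding \<open>w\<close> at \<open>p\<close>.\<close>

lemma join_irr_le_iff:
  assumes z: "z \<in> brackets"
  shows "join_irr p w \<le> z \<longleftrightarrow> w < z p"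
proof
  assume "join_irr p w \<le> z"
  then show "w < z p" using join_irr_p unfolding le_fun_def by (metis Suc_eq_plus1 Suc_le_eq)
next
  assume wz: "w < z p"
  show "join_irr p w \<le> z"
  proof (rule le_funI)
    fix i
    show "join_irr p w i \<le> z i"
    proof (cases "N * (p div N) < i \<and> i \<le> p")
      case True
      then have "i \<le> N * n" using arcD(4) by simp
      then have "p \<le> N * z i" using column_le True le_mult[OF z] by blast
      then have "z p \<le> z i" using nested'[OF z] True by blast
      then show ?thesis using True \<open>i \<le> N * n\<close> wz unfolding join_irr_def by simp
    next
      case False
      then show ?thesis using ceil_le[OF z] unfolding join_irr_def by auto
    qed
  qed
qed

text \<open>At multiples of \<open>N\<close> all bracket vectors agree, and elsewhere outside the
  interval \<open>kap p w\<close> has the maximal value \<open>n\<close>, so only the interval can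
  obstruct.\<close>

lemma le_kap_iff:
  assumes z: "z \<in> brackets"
  shows "z \<le> kap p w \<longleftrightarrow> (\<forall>i. p \<le> i \<and> i \<le> N * w \<longrightarrow> z i \<le> w)"
proof
  assume le: "z \<le> kap p w"
  show "\<forall>i. p \<le> i \<and> i \<le> N * w \<longrightarrow> z i \<le> w"
  proof (intro allI impI)
    fix i assume i: "p \<le> i \<and> i \<le> N * w"
    then have "kap p w i \<le> w" using N_ge2 unfolding kap_def by (auto elim!: dvdE)
    then show "z i \<le> w" using le unfolding le_fun_def by (meson le_trans)
  qed
next
  assume "\<forall>i. p \<le> i \<and> i \<le> N * w \<longrightarrow> z i \<le> w"
  then show "z \<le> kap p w"
    using at_dvd[OF z] le_n[OF z] outside[OF z] unfolding kap_def le_fun_def by auto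
qed

text \<open>Minimality of \<open>join_irr p w\<close> among the vectors exceeding \<open>w\<close>
  at \<open>p\<close> forces every lowering to act at \<open>p\<close>. A single arc will mean a
  single lower cover.\<close>

lemma down_arcs_join_irr: "down_arcs (join_irr p w) = {(p, w)}"
proof -
  have le: "join_irr p w j \<le> w" if "p < j" "j \<le> N * w" for j
    using that ceil_le_iff unfolding join_irr_def by auto
  \<comment> \<open>Inside the vector, this position carries the ceiling \<open>w + 1\<close> and
    not the default 0.\<close>
  have "N * w + 1 \<le> N * n" using mult_less_step1 arcD(3) by simp
  moreover note ceil_mult_Suc[of w]
  ultimately have "join_irr p w (N * w + 1) = w + 1"
    using arcD(2) unfolding join_irr_def by simp
  moreover have "1 \<le> p" using arcD(1) by (cases p) auto
  ultimately have pw: "(p, w) \<in> down_arcs (join_irr p w)"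
    using le arcD join_irr_p unfolding down_arcs_def by auto
  have "q = p \<and> u = w" if qu: "(q, u) \<in> down_arcs (join_irr p w)" for q u
  proof -
    let ?c = "(join_irr p w)(q := u)"
    have "\<not> join_irr p w \<le> ?c"
      using down_arcD(5)[OF join_irr_in_brackets qu] by (metis fun_upd_same le_fun_def not_less)
    then have "\<not> w < ?c p"
      using join_irr_le_iff lower_in_brackets[OF join_irr_in_brackets qu] by blast
    then have "q = p" using join_irr_p by (metis fun_upd_other less_add_one)
    then show ?thesis using down_arc_unique[OF join_irr_in_brackets] qu pw by blast
  qed
  then show ?thesis using pw by auto
qed

end

lemma join_irr_inj:
  assumes "(p, w) \<in> arcs" "(q, u) \<in> arcs" "join_irr p w = join_irr q u"
  shows "p = q \<and> w = u"
proof -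
  have "{(p, w)} = {(q, u)}"
    using down_arcs_join_irr[OF assms(1)] down_arcs_join_irr[OF assms(2)] assms(3) by metis
  then show ?thesis by simp
qed

section \<open>Cover relations and up arcs\<close>

definition covered :: "(nat \<Rightarrow> nat) \<Rightarrow> (nat \<Rightarrow> nat) \<Rightarrow> bool" where
  "covered x y \<longleftrightarrow> x \<in> brackets \<and> y \<in> brackets \<and> x < y \<and> \<not> (\<exists>z\<in>brackets. x < z \<and> z < y)"

lemma lower_less:
  assumes "y \<in> brackets" "(p, w) \<in> down_arcs y"
  shows "y(p := w) < y"
proof -
  have "w < y p" using down_arcD(5) assms by blast
  then show ?thesis by (auto simp: less_fun_def le_fun_def)
qed

text \<open>Everything strictly below \<open>y\<close> lies below some lowering of \<open>y\<close>.
  Two different lowerings are incomparable, since they act at different positions, so each of them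
  is covered by \<open>y\<close>.\<close>

lemma covered_iff:
  assumes y: "y \<in> brackets"
  shows "covered x y \<longleftrightarrow> (\<exists>p w. (p, w) \<in> down_arcs y \<and> x = y(p := w))"
proof
  assume c: "covered x y"
  then have "x \<in> brackets" "x \<le> y" "x \<noteq> y" unfolding covered_def by auto
  then obtain p w where pw: "(p, w) \<in> down_arcs y" "x \<le> y(p := w)"
    using below_some_lower[OF y] by blast
  then have "\<not> x < y(p := w)"
    using c lower_less[OF y pw(1)] lower_in_brackets[OF y pw(1)] unfolding covered_def by blast
  then have "x = y(p := w)" using pw(2) by simp
  then show "\<exists>p w. (p, w) \<in> down_arcs y \<and> x = y(p := w)" using pw by blast
next
  assume "\<exists>p w. (p, w) \<in> down_arcs y \<and> x = y(p := w)"
  then obtain p w where pw: "(p, w) \<in> down_arcs y" "x = y(p := w)" by blast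
  have "\<not> (x < z \<and> z < y)" if z: "z \<in> brackets" for z
  proof
    assume a: "x < z \<and> z < y"
    then obtain q u where qu: "(q, u) \<in> down_arcs y" "z \<le> y(q := u)"
      using below_some_lower[OF y z] by (metis less_le)
    have "x \<le> y(q := u)" using a qu(2) by (meson less_imp_le order_trans)
    then have "x q \<le> u" by (metis fun_upd_same le_fun_def)
    then have "q = p" using down_arcD(5)[OF y qu(1)] pw(2) by (metis fun_upd_other not_less)
    then have "u = w" using down_arc_unique[OF y] qu(1) pw(1) by blast
    then have "z \<le> x" using qu(2) pw(2) \<open>q = p\<close> by simp
    then show False using a by (meson leD)
  qed
  then show "covered x y"
    unfolding covered_def using y lower_less[OF y pw(1)] lower_in_brackets[OF y pw(1)] pw(2) by blast
qed

lemma up_arcD: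
  assumes z: "z \<in> brackets" and "(p, w) \<in> up_arcs z"
  shows "\<not> N dvd p" "z p = w" "w < n" "\<And>j. j < p \<Longrightarrow> z j \<noteq> w"
    "1 \<le> w" "1 \<le> p" "p < N * w" "p \<le> N * n"
proof -
  show *: "\<not> N dvd p" "z p = w" "w < n" "\<And>j. j < p \<Longrightarrow> z j \<noteq> w"
    using assms(2) unfolding up_arcs_def by simp_all
  show p: "1 \<le> p" using *(1) by (cases p) auto
  \<comment> \<open>The value 0 occurs at position 0, before \<open>p\<close>.\<close>
  then have w: "w \<noteq> 0" using *(4)[of 0] at_0[OF z] by simp
  then show "1 \<le> w" by simp
  show "p < N * w" using le_mult'[OF z *(2) w] *(1) by (metis dvd_triv_left le_neq_implies_less)
  show "p \<le> N * n" using pos_le[OF z] w *(2) by simp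
qed

lemma raise_in_brackets:
  assumes z: "z \<in> brackets" and arc: "(p, w) \<in> up_arcs z"
  shows "z(p := z (N * w + 1)) \<in> brackets"
proof (rule bracketsI)
  note u = up_arcD[OF z arc]
  let ?k = "z (N * w + 1)"
  have k: "w < ?k" using next_gt[OF z u(3)] .
  show "(z(p := ?k)) (N * i) = i" if "i \<le> n" for i
    using u(1) at_mult[OF z] that by auto
  have "p \<le> N * ?k" using k u(7) by (metis less_imp_le le_trans mult_le_mono2)
  then show "i \<le> N * (z(p := ?k)) i" if "i \<le> N * n" for i
    using le_mult[OF z] that by auto
  show "(z(p := ?k)) i \<le> n" for i using le_n[OF z] by auto
  show "(z(p := ?k)) i = 0" if "i > N * n" for i using u(8) outside[OF z] that by auto
  fix i j assume ij: "i < j" "j \<le> N * (z(p := ?k)) i"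
  consider "i = p" | "i \<noteq> p" "j = p" | "i \<noteq> p" "j \<noteq> p" by blast
  then show "(z(p := ?k)) j \<le> (z(p := ?k)) i"
  proof cases
    case 1
    \<comment> \<open>Up to \<open>N * w\<close> nesting at \<open>p\<close> applies, later on
      nesting at \<open>N * w + 1\<close>.\<close>
    have "z j \<le> ?k"
    proof (cases "j \<le> N * w")
      case True
      then have "z j \<le> w" using nested[OF z, of p j] ij 1 u(2) by simp
      then show ?thesis using k by simp
    next
      case False
      then show ?thesis using nested'[OF z, of "N * w + 1" j] ij 1 by simp
    qed
    then show ?thesis using 1 ij by simp
  next
    \<comment> \<open>Here \<open>i\<close> reaches \<open>p\<close>, so \<open>z i\<close> is at
      least \<open>w\<close>, and it is not \<open>w\<close> because \<open>p\<close> is the first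
      occurrence; hence \<open>i\<close> also reaches \<open>N * w + 1\<close>.\<close>
    case 2
    then have "w \<le> z i" "z i \<noteq> w" using nested[OF z ij(1)] ij u(2,4) by auto
    then have "N * w + 1 \<le> N * z i" using mult_less_step1 by simp
    moreover have "i < N * w + 1" using 2 ij(1) u(7) by simp
    ultimately have "?k \<le> z i" using nested[OF z] by blast
    then show ?thesis using 2 by simp
  next
    case 3
    then show ?thesis using nested[OF z ij(1)] ij by simp
  qed
qed

text \<open>Raising the entry at \<open>p\<close> to \<open>z (N * w + 1)\<close> undoes a lowering.
  Conversely, an earlier occurrence of \<open>w\<close> in \<open>y\<close> would reach
  \<open>p\<close> and force \<open>y p \<le> w\<close>.\<close>

lemma up_arcs_iff:
  assumes z: "z \<in> brackets"
  shows "(p, w) \<in> up_arcs z \<longleftrightarrow> (\<exists>y\<in>brackets. (p, w) \<in> down_arcs y \<and> z = y(p := w))"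
proof
  assume arc: "(p, w) \<in> up_arcs z"
  note u = up_arcD[OF z arc]
  let ?y = "z(p := z (N * w + 1))"
  have "z j \<le> w" if "p < j" "j \<le> N * w" for j
    using nested[OF z, of p j] that u(2) by simp
  then have "(p, w) \<in> down_arcs ?y" using u unfolding down_arcs_def by auto
  moreover have "z = ?y(p := w)" using u(2) by auto
  ultimately show "\<exists>y\<in>brackets. (p, w) \<in> down_arcs y \<and> z = y(p := w)"
    using raise_in_brackets[OF z arc] by blast
next
  assume "\<exists>y\<in>brackets. (p, w) \<in> down_arcs y \<and> z = y(p := w)"
  then obtain y where y: "y \<in> brackets" "(p, w) \<in> down_arcs y" "z = y(p := w)" by blast
  note d = down_arcD[OF y(1,2)]
  have "z j \<noteq> w" if "j < p" for j
  proof
    assume "z j = w"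
    then have "y j = w" using y(3) that by simp
    then have "y p \<le> w" using nested[OF y(1) that] d(3) by simp
    then show False using d(5) by simp
  qed
  then show "(p, w) \<in> up_arcs z" using d y(3) unfolding up_arcs_def by auto
qed

text \<open>A value \<open>w < n\<close> of \<open>y\<close> at a non-multiple \<open>i\<close>
  first occurs at the left end \<open>p\<close> of an up arc. If \<open>z\<close> shares that arc,
  nesting at \<open>p\<close> bounds \<open>z i\<close> by \<open>w\<close> as well.\<close>

lemma up_arcs_mono:
  assumes y: "y \<in> brackets" and z: "z \<in> brackets" and sub: "up_arcs y \<subseteq> up_arcs z"
  shows "z \<le> y"
proof (rule le_funI)
  fix i
  consider "N * n < i" | "N dvd i" "i \<le> N * n" | "y i = n"
    | "\<not> N dvd i" "i \<le> N * n" "y i < n"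
    using le_n[OF y, of i] by force
  then show "z i \<le> y i"
  proof cases
    case 4
    define w where "w = y i"
    obtain p where p: "y p = w" "p \<le> i" "\<And>j. j < p \<Longrightarrow> y j \<noteq> w"
      using first_occurrence[of y i w] w_def by blast
    have iw: "i \<le> N * w" using le_mult[OF y 4(2)] w_def by simp
    \<comment> \<open>Otherwise \<open>p = N * w\<close>, and \<open>p \<le> i \<le> N * w\<close>
      would make \<open>i\<close> a multiple of \<open>N\<close>.\<close>
    have "\<not> N dvd p"
    proof
      assume "N dvd p"
      moreover have "p \<le> N * n" using p(2) 4(2) by simp
      ultimately have "p = N * w"
        using at_dvd[OF y, of p] p(1) dvd_mult_div_cancel[of N p] by simp
      then show False using 4(1) p(2) iw by (metis dvd_triv_left le_antisym)
    qed
    then have "(p, w) \<in> up_arcs y" using p 4(3) w_def unfolding up_arcs_def by simp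
    then have "z p = w" using sub unfolding up_arcs_def by auto
    then show ?thesis using nested'[OF z p(2)] iw w_def by simp
  qed (use outside[OF z] at_dvd[OF y] at_dvd[OF z] le_n[OF z] in auto)
qed

section \<open>Rowmotion in terms of arcs\<close>

text \<open>The entrywise minimum of the vectors \<open>kap p w\<close> over the down arcs of
  \<open>x\<close>; where no arc spans \<open>i\<close>, the entry is \<open>n\<close>, as in the
  greatest bracket vector.\<close>

definition rowm :: "(nat \<Rightarrow> nat) \<Rightarrow> nat \<Rightarrow> nat" where
  "rowm x i = (if i > N * n then 0 else if N dvd i then i div N
     else LEAST w. w = n \<or> i \<le> N * w \<and> (\<exists>p\<le>i. (p, w) \<in> down_arcs x))"

context
  fixes x assumes x: "x \<in> brackets"
begin

lemma rowm_le:
  assumes "p \<le> i" "i \<le> N * w" "(p, w) \<in> down_arcs x"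
  shows "rowm x i \<le> w"
proof -
  have "i \<le> N * n" using assms(2) mult_less_step1[OF down_arcD(4)[OF x assms(3)]] by linarith
  then show ?thesis using assms N_ge2 unfolding rowm_def by (auto intro!: Least_le elim!: dvdE)
qed

lemma rowm_cases:
  assumes "\<not> N dvd i" "i \<le> N * n"
  obtains "rowm x i = n"
  | p where "p \<le> i" "i \<le> N * rowm x i" "(p, rowm x i) \<in> down_arcs x"
proof -
  let ?P = "\<lambda>w. w = n \<or> i \<le> N * w \<and> (\<exists>p\<le>i. (p, w) \<in> down_arcs x)"
  have "?P (LEAST w. ?P w)" by (rule LeastI[of ?P n]) simp
  moreover have "rowm x i = (LEAST w. ?P w)" using assms unfolding rowm_def by simp
  ultimately have "?P (rowm x i)" by simp
  then show ?thesis using that by auto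
qed

lemma rowm_le_n: "rowm x i \<le> n"
  using N_ge2 unfolding rowm_def by (auto intro!: Least_le elim!: dvdE)

lemma rowm_in_brackets: "rowm x \<in> brackets"
proof (rule bracketsI)
  show "rowm x (N * k) = k" if "k \<le> n" for k
    using that N_ge2 unfolding rowm_def by auto
  show "i \<le> N * rowm x i" if "i \<le> N * n" for i
  proof (cases "N dvd i")
    case True
    then show ?thesis using that unfolding rowm_def by simp
  next
    case False
    then show ?thesis by (rule rowm_cases) (use that in auto)
  qed
  show "rowm x i \<le> n" for i by (rule rowm_le_n)
  show "rowm x i = 0" if "i > N * n" for i using that unfolding rowm_def by simp
  fix i j
  assume ij: "i < j" "j \<le> N * rowm x i" "i \<le> N * n" "j \<le> N * n"
  show "rowm x j \<le> rowm x i"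
  proof (cases "N dvd i")
    case True
    then show ?thesis using ij unfolding rowm_def by simp
  next
    case False
    then show ?thesis
    proof (rule rowm_cases)
      assume "rowm x i = n"
      then show ?thesis using rowm_le_n by simp
    next
      \<comment> \<open>The arc that determines the value at \<open>i\<close> also spans
        \<open>j\<close>.\<close>
      fix p assume "p \<le> i" "i \<le> N * rowm x i" "(p, rowm x i) \<in> down_arcs x"
      then show ?thesis using rowm_le[of p j] ij by simp
    qed (rule ij)
  qed
qed

text \<open>Down arcs do not cross: an arc \<open>(q, u)\<close> with \<open>u < w\<close> spanning
  \<open>p\<close> would have \<open>q < p\<close>, hence \<open>x p \<le> u\<close>, against
  \<open>w < x p\<close>.\<close>

lemma rowm_left_end:
  assumes arc: "(p, w) \<in> down_arcs x"
  shows "rowm x p = w"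
proof (rule ccontr)
  note d = down_arcD[OF x arc]
  assume "rowm x p \<noteq> w"
  then have lt: "rowm x p < w" using rowm_le[of p p w] arc d(3) by simp
  define u where "u = rowm x p"
  have "p \<le> N * n" using d(8) by simp
  then show False
  proof (rule rowm_cases[OF d(1)])
    fix q assume q: "q \<le> p" "p \<le> N * rowm x p" "(q, rowm x p) \<in> down_arcs x"
    note dq = down_arcD[OF x q(3)]
    have "q \<noteq> p" using down_arc_unique[OF x arc] q(3) lt by blast
    then have "x p \<le> u" using dq(7)[of p] q u_def by simp
    then show False using d(5) lt u_def by simp
  qed (use lt d(4) in simp)
qed

text \<open>The defining property of rowmotion in terms of arcs. A value \<open>w < n\<close> of
  \<open>rowm x\<close> off the multiples of \<open>N\<close> comes from a down arc ending at
  \<open>w\<close>; there is only one, and its left end is where \<open>w\<close> first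
  occurs.\<close>

lemma up_arcs_rowm: "up_arcs (rowm x) = down_arcs x"
proof (intro equalityI subrelI)
  fix p w assume arc: "(p, w) \<in> down_arcs x"
  note d = down_arcD[OF x arc]
  have "rowm x j \<noteq> w" if j: "j < p" for j
  proof
    assume jw: "rowm x j = w"
    have jn: "j \<le> N * n" using j d(8) by simp
    have "\<not> N dvd j" using jw j d(3) at_dvd[OF rowm_in_brackets _ jn] by auto
    then show False
    proof (rule rowm_cases[OF _ jn])
      fix q assume "q \<le> j" "(q, rowm x j) \<in> down_arcs x"
      then show False using down_arc_unique'[OF x arc, of q] jw j by simp
    qed (use jw d(4) in simp)
  qed
  then show "(p, w) \<in> up_arcs (rowm x)"
    using d rowm_left_end[OF arc] unfolding up_arcs_def by auto
next
  fix p w assume arc: "(p, w) \<in> up_arcs (rowm x)"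
  note u = up_arcD[OF rowm_in_brackets arc]
  show "(p, w) \<in> down_arcs x"
  proof (rule rowm_cases[OF u(1) u(8)])
    fix q assume q: "q \<le> p" "(q, rowm x p) \<in> down_arcs x"
    then have "rowm x q = w" using rowm_left_end u(2) by simp
    then have "q = p" using u(4)[of q] q(1) by (cases "q = p") auto
    then show ?thesis using q(2) u(2) by simp
  qed (use u in simp)
qed

end

lemma up_arcs_inj:
  "y \<in> brackets \<Longrightarrow> z \<in> brackets \<Longrightarrow> up_arcs y = up_arcs z \<Longrightarrow> y = z"
  using up_arcs_mono by (metis order_antisym order_refl)

text \<open>The arcs determine the vector from right to left: an arc \<open>(i, w)\<close> copies
  the value from \<open>N * w + 1\<close>, and at a non-multiple without an arc there is no descent,
  so the value is that at \<open>i + 1\<close>.\<close>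

lemma down_arcs_inj:
  assumes x: "x \<in> brackets" and y: "y \<in> brackets" and eq: "down_arcs x = down_arcs y"
  shows "x = y"
proof
  fix i
  show "x i = y i"
  proof (induction "N * n - i" arbitrary: i rule: less_induct)
    case less
    have "\<not> N dvd i \<Longrightarrow> i \<noteq> N * n" by auto
    then consider "N * n < i" | "N dvd i" "i \<le> N * n" | "\<not> N dvd i" "i < N * n"
      by linarith
    then show ?case
    proof cases
      case 3
      show ?thesis
      proof (cases "\<exists>w. (i, w) \<in> down_arcs x")
        case True
        then obtain w where w: "(i, w) \<in> down_arcs x" by blast
        have "x (N * w + 1) = y (N * w + 1)"
          by (rule less) (use down_arcD(3,4)[OF x w] mult_less_step1[of w n] 3 in linarith)
        then show ?thesis using down_arcD(6)[OF x w] down_arcD(6)[OF y] w eq by simp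
      next
        case False
        have "z (i + 1) = z i" if "z \<in> brackets" "down_arcs z = down_arcs x" for z
          using descent_down_arc[OF that(1) 3(1)] succ_le[OF that(1) 3(1)] 3(2) False that(2)
          by (metis le_neq_implies_less less_imp_le)
        moreover have "x (i + 1) = y (i + 1)" by (rule less) (use 3 in linarith)
        ultimately show ?thesis using x y eq by metis
      qed
    qed (use outside[OF x] outside[OF y] at_dvd[OF x] at_dvd[OF y] in auto)
  qed
qed

lemma rowm_inj: "inj_on rowm brackets"
  using up_arcs_rowm down_arcs_inj by (metis inj_onI)

section \<open>Rotation of the block minima\<close>

text \<open>The bound 2 leaves out position 0, which is outside the partition, and position 1, which
  is a block minimum for every bracket vector.\<close>

definition minima :: "(nat \<Rightarrow> nat) \<Rightarrow> nat set" where
  "minima x = {q. 2 \<le> q \<and> q \<le> N * n \<and> (\<forall>j<q. x j \<noteq> x q)}"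

definition minima_mod :: "(nat \<Rightarrow> nat) \<Rightarrow> nat \<Rightarrow> nat set" where
  "minima_mod x r = {q \<in> minima x. q mod N = r}"

lemma finite_minima [simp]: "finite (minima x)"
  by (rule finite_subset[of _ "{..N * n}"]) (auto simp: minima_def)

lemma finite_minima_mod [simp]: "finite (minima_mod x r)"
  unfolding minima_mod_def by simp

context
  fixes x assumes x: "x \<in> brackets"
begin

text \<open>Each of the values 1 to \<open>n\<close> occurs, \<open>v\<close> at
  \<open>N * v\<close>, and so has a first occurrence; only that of \<open>x 1\<close> is
  discarded.\<close>

lemma card_minima: "card (minima x) = n - 1"
proof -
  have n1: "1 \<le> N * n" using n_pos N_ge2 by simp
  have inj: "inj_on x (minima x)"
    unfolding inj_on_def minima_def by (metis (mono_tags, lifting) linorder_neqE_nat mem_Collect_eq)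
  have "x ` minima x = {1..n} - {x 1}"
  proof (intro equalityI subsetI)
    fix v assume "v \<in> x ` minima x"
    then obtain q where q: "v = x q" "2 \<le> q" "q \<le> N * n" "\<And>j. j < q \<Longrightarrow> x j \<noteq> x q"
      unfolding minima_def by auto
    have "1 \<le> x q" using pos[OF x, of q] q by simp
    moreover have "x 1 \<noteq> x q" using q(2) q(4)[of 1] by simp
    ultimately show "v \<in> {1..n} - {x 1}" using le_n[OF x, of q] q(1) by simp
  next
    fix v assume v: "v \<in> {1..n} - {x 1}"
    have "x (N * v) = v" using at_mult[OF x] v by simp
    then obtain q where q: "x q = v" "q \<le> N * v" "\<And>j. j < q \<Longrightarrow> x j \<noteq> v"
      using first_occurrence by metis
    have "q = 0 \<Longrightarrow> v = 0" using q(1) at_0[OF x] by simp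
    then have "q \<noteq> 0" "q \<noteq> 1" using q(1) v by auto
    moreover have "q \<le> N * n" using order_trans[OF q(2), of "N * n"] v by simp
    ultimately have "q \<in> minima x" using q unfolding minima_def by auto
    then show "v \<in> x ` minima x" using q(1) by blast
  qed
  moreover have "card ({1..n} - {x 1}) = n - 1"
    using pos[OF x, of 1] le_n[OF x, of 1] n1 by simp
  ultimately show ?thesis using card_image[OF inj] by simp
qed

lemma sum_minima_mod: "(\<Sum>r<N. card (minima_mod x r)) = n - 1"
proof -
  have "minima x = (\<Union>r<N. minima_mod x r)"
    using N_ge2 unfolding minima_mod_def by auto
  moreover have "card (\<Union>r<N. minima_mod x r) = (\<Sum>r<N. card (minima_mod x r))"
    by (rule card_UN_disjoint) (auto simp: minima_mod_def)
  ultimately show ?thesis using card_minima by simp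
qed

text \<open>Take the last position up to \<open>N * w\<close> that shares the value of
  \<open>N * w + 1\<close>. A later entry above \<open>w\<close> would be squeezed by nesting from
  both sides to that same value.\<close>

lemma last_common_arc:
  assumes w: "w < n" and j: "1 \<le> j" "j \<le> N * w" "x j = x (N * w + 1)"
  obtains p where "(p, w) \<in> down_arcs x"
proof -
  define u where "u = x (N * w + 1)"
  define S where "S = {p. p \<le> N * w \<and> x p = u}"
  have fin: "finite S" unfolding S_def by simp
  have "j \<in> S" using j u_def unfolding S_def by simp
  define p where "p = Max S"
  have p: "p \<in> S" "j \<le> p" using Max_in[OF fin] Max_ge[OF fin] \<open>j \<in> S\<close> p_def by auto
  have "w < u" using next_gt[OF x w] u_def by simp
  have "x i \<le> w" if i: "p < i" "i \<le> N * w" for i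
  proof (rule ccontr)
    assume "\<not> x i \<le> w"
    then have "N * w + 1 \<le> N * x i" using mult_less_step1 by simp
    then have "u \<le> x i" using nested[OF x, of i "N * w + 1"] i u_def by simp
    moreover have "x i \<le> u"
      using nested[OF x i(1)] p(1) i(2) mult_less_step1[OF \<open>w < u\<close>] unfolding S_def by simp
    ultimately have "i \<in> S" using i unfolding S_def by simp
    then show False using Max_ge[OF fin, of i] i(1) p_def by simp
  qed
  then have "(p, w) \<in> down_arcs x"
    using p j(1) w u_def unfolding down_arcs_def S_def by auto
  then show ?thesis using that by blast
qed

text \<open>Sending \<open>(p, w)\<close> to its right end \<open>N * w + 1\<close> matches the down
  arcs with those of the \<open>n - 1\<close> positions \<open>N * w + 1\<close>,
  \<open>1 \<le> w < n\<close>, that are not block minima.\<close>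

lemma card_down_arcs: "card (down_arcs x) + card (minima_mod x 1) = n - 1"
proof -
  let ?g = "\<lambda>w. N * w + 1"
  let ?T = "?g ` {1..<n}"
  have injg: "inj_on ?g A" for A using N_ge2 by (auto simp: inj_on_def)
  have modg: "?g w mod N = 1" for w using N_ge2 by (simp only: mod_mult_self4) simp
  have gn: "?g w \<le> N * n" if "w < n" for w using mult_less_step1 that by simp
  have sub: "minima_mod x 1 \<subseteq> ?T"
  proof
    fix q assume "q \<in> minima_mod x 1"
    then have q: "2 \<le> q" "q \<le> N * n" "q mod N = 1" unfolding minima_mod_def minima_def by auto
    then have e: "q = ?g (q div N)" by (metis mult_div_mod_eq)
    have "q div N < n" using q(2) e by (metis Suc_eq_plus1 Suc_le_eq mult_less_cancel1)
    moreover have "q div N \<noteq> 0" using e q(1) by (intro notI) simp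
    ultimately show "q \<in> ?T" using e by auto
  qed
  have inj: "inj_on (\<lambda>(p, w). ?g w) (down_arcs x)"
    using down_arc_unique'[OF x] N_ge2 by (auto simp: inj_on_def)
  have "(\<lambda>(p, w). ?g w) ` down_arcs x = ?T - minima_mod x 1"
  proof (intro equalityI subsetI)
    fix q assume "q \<in> (\<lambda>(p, w). ?g w) ` down_arcs x"
    then obtain p w where a: "(p, w) \<in> down_arcs x" "q = ?g w" by auto
    note d = down_arcD[OF x a(1)]
    have "w \<noteq> 0" using d(3) by (intro notI) simp
    moreover have "p < q" "x p = x q" using d(3,6) a(2) by auto
    then have "q \<notin> minima x" unfolding minima_def by auto
    ultimately show "q \<in> ?T - minima_mod x 1" using a(2) d(4) unfolding minima_mod_def by auto
  next
    fix q assume q: "q \<in> ?T - minima_mod x 1"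
    then have "q \<in> ?T" by blast
    then obtain w where "q = ?g w" "w \<in> {1..<n}" by (rule imageE)
    then have w: "q = ?g w" "1 \<le> w" "w < n" by simp_all
    have "2 \<le> q" using w N_ge2 mult_le_mono[of 2 N 1 w] by simp
    then obtain j where j: "j < q" "x j = x q"
      using q w gn modg unfolding minima_mod_def minima_def by auto
    have "j \<noteq> 0" using j(2) at_0[OF x] next_gt[OF x w(3)] w(1) by (intro notI) simp
    then obtain p where "(p, w) \<in> down_arcs x" using last_common_arc[of w j] w j by auto
    then show "q \<in> (\<lambda>(p, w). ?g w) ` down_arcs x" using w(1) by force
  qed
  then have "card (down_arcs x) = card (?T - minima_mod x 1)" using card_image[OF inj] by simp
  moreover have "card ?T = n - 1" using card_image[OF injg] by simp
  ultimately show ?thesis using card_Diff_subset[OF _ sub] card_mono[OF _ sub] by simp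
qed

lemma before_end: "x (N * n - 1) = n"
proof (rule ccontr)
  assume "x (N * n - 1) \<noteq> n"
  then have "x (N * n - 1) < n" using le_n[OF x] by (simp add: le_neq_implies_less)
  then have "N * x (N * n - 1) + N \<le> N * n" by (rule mult_less_step)
  moreover have "N * n - 1 \<le> N * x (N * n - 1)" by (rule le_mult[OF x]) simp
  ultimately show False using N_ge2 by linarith
qed

text \<open>Sending \<open>(p, w)\<close> to the block maximum \<open>N * w\<close> matches the up
  arcs with those of the \<open>n - 1\<close> positions \<open>N * w\<close>,
  \<open>1 \<le> w < n\<close>, that are not block minima. By \<open>before_end\<close>,
  \<open>N * n\<close> is never a block minimum.\<close>

lemma card_up_arcs: "card (up_arcs x) + card (minima_mod x 0) = n - 1"
proof -
  let ?g = "\<lambda>w. N * w"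
  let ?T = "?g ` {1..<n}"
  have injg: "inj_on ?g A" for A using N_ge2 by (auto simp: inj_on_def)
  have sub: "minima_mod x 0 \<subseteq> ?T"
  proof
    fix q assume "q \<in> minima_mod x 0"
    then have q: "2 \<le> q" "q \<le> N * n" "q mod N = 0" "\<And>j. j < q \<Longrightarrow> x j \<noteq> x q"
      unfolding minima_mod_def minima_def by auto
    then obtain w where w: "q = N * w" by auto
    have "w \<le> n" using q(2) w N_ge2 by simp
    moreover have "w \<noteq> n"
    proof
      assume "w = n"
      then have "N * n - 1 < q" using w q(1) by simp
      then show False
        using q(4) before_end at_mult[OF x, of n] w \<open>w = n\<close> by (metis order_refl)
    qed
    moreover have "w \<noteq> 0" using q(1) w by (intro notI) simp
    ultimately show "q \<in> ?T" using w by auto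
  qed
  have inj: "inj_on (\<lambda>(p, w). ?g w) (up_arcs x)"
    unfolding inj_on_def up_arcs_def using N_ge2 by auto (metis linorder_neqE_nat)
  have "(\<lambda>(p, w). ?g w) ` up_arcs x = ?T - minima_mod x 0"
  proof (intro equalityI subsetI)
    fix q assume "q \<in> (\<lambda>(p, w). ?g w) ` up_arcs x"
    then obtain p w where a: "(p, w) \<in> up_arcs x" "q = ?g w" by auto
    note d = up_arcD[OF x a(1)]
    have "x (N * w) = w" using at_mult[OF x] d(3) by simp
    then have "q \<notin> minima x" using d(2,7) a(2) unfolding minima_def by auto
    then show "q \<in> ?T - minima_mod x 0" using a(2) d(3,5) unfolding minima_mod_def by auto
  next
    fix q assume q: "q \<in> ?T - minima_mod x 0"
    then have "q \<in> ?T" by blast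
    then obtain w where "q = ?g w" "w \<in> {1..<n}" by (rule imageE)
    then have w: "q = ?g w" "1 \<le> w" "w < n" by simp_all
    have "2 \<le> q" using w N_ge2 mult_le_mono[of 2 N 1 w] by simp
    moreover have "q \<le> N * n" using w by simp
    moreover have xq: "x q = w" using at_mult[OF x] w by simp
    ultimately obtain j where j: "j < q" "x j = w"
      using q w unfolding minima_mod_def minima_def by auto
    obtain p where p: "x p = w" "p \<le> j" "\<And>j. j < p \<Longrightarrow> x j \<noteq> w"
      using first_occurrence[of x j w] j(2) by blast
    have "p \<le> N * n" using p(2) j(1) \<open>q \<le> N * n\<close> by simp
    then have "\<not> N dvd p" using at_dvd[OF x, of p] p j(1) w(1) by auto
    then have "(p, w) \<in> up_arcs x" using p w(3) unfolding up_arcs_def by simp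
    then show "q \<in> (\<lambda>(p, w). ?g w) ` up_arcs x" using w(1) by force
  qed
  then have "card (up_arcs x) = card (?T - minima_mod x 0)" using card_image[OF inj] by simp
  moreover have "card ?T = n - 1" using card_image[OF injg] by simp
  ultimately show ?thesis using card_Diff_subset[OF _ sub] card_mono[OF _ sub] by simp
qed

text \<open>A minimum \<open>q\<close> of residue at least 2 has value below \<open>n\<close>, hence
  starts an up arc: \<open>q - 1\<close> is no multiple of \<open>N\<close>, so \<open>x q\<close>
  is at most \<open>x (q - 1)\<close> and differs from it.\<close>

lemma card_up_arcs_mod:
  assumes r: "2 \<le> r" "r < N"
  shows "card {(p, w) \<in> up_arcs x. p mod N = r} = card (minima_mod x r)"
proof -
  let ?U = "{(p, w) \<in> up_arcs x. p mod N = r}"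
  have inj: "inj_on fst ?U" unfolding inj_on_def up_arcs_def by auto
  have "fst ` ?U = minima_mod x r"
  proof (intro equalityI subsetI)
    fix p assume "p \<in> fst ` ?U"
    then obtain w where a: "(p, w) \<in> up_arcs x" "p mod N = r" by auto
    note d = up_arcD[OF x a(1)]
    have "2 \<le> p" using a(2) r(1) mod_less_eq_dividend[of p N] by linarith
    then show "p \<in> minima_mod x r" using d a(2) unfolding minima_mod_def minima_def by auto
  next
    fix q assume "q \<in> minima_mod x r"
    then have q: "2 \<le> q" "q \<le> N * n" "q mod N = r" "\<And>j. j < q \<Longrightarrow> x j \<noteq> x q"
      unfolding minima_mod_def minima_def by auto
    have nd: "\<not> N dvd q" using q(3) r by auto
    have "\<not> N dvd (q - 1)"
    proof
      assume "N dvd (q - 1)"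
      then have "Suc (q - 1) mod N = 1" using r by (simp add: mod_Suc)
      then show False using q(1,3) r by simp
    qed
    then have "x q \<le> x (q - 1)" using succ_le[OF x, of "q - 1"] q(1,2) by simp
    moreover have "x (q - 1) \<noteq> x q" using q(1,4) by simp
    ultimately have "x q < n" using le_n[OF x, of "q - 1"] by simp
    then have "(q, x q) \<in> ?U" using nd q unfolding up_arcs_def by simp
    then show "q \<in> fst ` ?U" by force
  qed
  then show ?thesis using card_image[OF inj] by simp
qed

text \<open>The bijection is \<open>(p, w) \<mapsto> p + 1\<close>. Off the multiples of
  \<open>N\<close>, arcs start exactly at the descents. After a descent \<open>p + 1\<close> is a
  block minimum, since an earlier position with its value would reach \<open>p\<close> and force
  \<open>x p \<le> x (p + 1)\<close>.\<close>

lemma card_down_arcs_mod: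
  assumes r: "1 \<le> r" "r < N"
  shows "card {(p, w) \<in> down_arcs x. p mod N = r} = card (minima_mod x (Suc r mod N))"
proof -
  let ?U = "{(p, w) \<in> down_arcs x. p mod N = r}"
  have inj: "inj_on (\<lambda>(p, w). Suc p) ?U"
    using down_arc_unique[OF x] unfolding inj_on_def by auto
  have "(\<lambda>(p, w). Suc p) ` ?U = minima_mod x (Suc r mod N)"
  proof (intro equalityI subsetI)
    fix q assume "q \<in> (\<lambda>(p, w). Suc p) ` ?U"
    then obtain p w where a: "(p, w) \<in> down_arcs x" "p mod N = r" "q = Suc p" by auto
    note d = down_arcD[OF x a(1)]
    have lt: "x q < x p" using d(7)[of q] d(3,5) a(3) by simp
    have "x j \<noteq> x q" if j: "j < q" for j
    proof
      assume e: "x j = x q"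
      then have "j < p" using lt j a(3) by (metis less_antisym less_irrefl)
      moreover have "q \<le> N * x q" using le_mult[OF x] d(8) a(3) by simp
      ultimately have "x p \<le> x q" using nested[OF x, of j p] a(3) e by simp
      then show False using lt by simp
    qed
    moreover have "q mod N = Suc r mod N" using a(2,3) by (metis mod_Suc_eq)
    ultimately show "q \<in> minima_mod x (Suc r mod N)"
      using d(2,8) a(3) unfolding minima_mod_def minima_def by auto
  next
    fix q assume "q \<in> minima_mod x (Suc r mod N)"
    then have q: "2 \<le> q" "q \<le> N * n" "q mod N = Suc r mod N" "\<And>j. j < q \<Longrightarrow> x j \<noteq> x q"
      unfolding minima_mod_def minima_def by auto
    define p where "p = q - 1"
    have qp: "q = Suc p" using q(1) p_def by simp
    have pr: "p mod N = r" using q(3) qp r by (auto simp: mod_Suc split: if_splits)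
    have nd: "\<not> N dvd p" using pr r by auto
    have "x (p + 1) \<le> x p" using succ_le[OF x nd] q(2) qp by simp
    moreover have "x p \<noteq> x (p + 1)" using q(4) qp by simp
    ultimately obtain w where "(p, w) \<in> down_arcs x"
      using descent_down_arc[OF x nd] q(2) qp by auto
    then show "q \<in> (\<lambda>(p, w). Suc p) ` ?U" using pr qp by force
  qed
  then show ?thesis using card_image[OF inj] by simp
qed

text \<open>The down arcs of \<open>x\<close> are the up arcs of \<open>rowm x\<close>; both counts
  of minima are \<open>n - 1\<close> minus the number of these arcs.\<close>

lemma minima_mod_rowm_0: "card (minima_mod (rowm x) 0) = card (minima_mod x 1)"
  using card_down_arcs m_tamari.card_up_arcs[OF m_tamari_axioms rowm_in_brackets[OF x]]
    up_arcs_rowm[OF x] by simp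

lemma minima_mod_rowm:
  "2 \<le> r \<Longrightarrow> r < N \<Longrightarrow> card (minima_mod (rowm x) r) = card (minima_mod x (Suc r mod N))"
  using card_down_arcs_mod[of r] up_arcs_rowm[OF x]
    m_tamari.card_up_arcs_mod[OF m_tamari_axioms rowm_in_brackets[OF x], of r] by simp

end

text \<open>The average over an invariant set, with denominators cleared so that it can be computed
  in the natural numbers.\<close>

lemma sum_card_down_arcs:
  assumes sub: "Q \<subseteq> brackets" and fin: "finite Q" and inv: "rowm ` Q \<subseteq> Q"
  shows "N * (\<Sum>x\<in>Q. card (down_arcs x)) = m * (n - 1) * card Q"
proof -
  define S where "S r = (\<Sum>x\<in>Q. card (minima_mod x r))" for r
  have inj: "inj_on rowm Q" using rowm_inj sub inj_on_subset by blast
  then have "rowm ` Q = Q" using endo_inj_surj[OF fin inv] by blast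
  \<comment> \<open>\<open>rowm\<close> permutes \<open>Q\<close>, so sums over \<open>Q\<close> may
    be reindexed along it.\<close>
  then have S_row: "S r = (\<Sum>x\<in>Q. card (minima_mod (rowm x) r))" for r
    using sum.reindex[OF inj, of "\<lambda>x. card (minima_mod x r)"] unfolding S_def by simp
  have S01: "S 0 = S 1"
    unfolding S_row[of 0] S_def[of 1] using minima_mod_rowm_0 sub by (intro sum.cong) auto
  \<comment> \<open>The case \<open>r = 1\<close> is not needed: the remaining equations already link all residues.\<close>
  have Ssuc: "S r = S (Suc r mod N)" if "2 \<le> r" "r < N" for r
    unfolding S_row[of r] S_def[of "Suc r mod N"] using minima_mod_rowm that sub
    by (intro sum.cong) auto
  \<comment> \<open>Downward induction from \<open>r = N\<close>, where \<open>r mod N\<close> is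
    0.\<close>
  have S2: "S (r mod N) = S 0" if "2 \<le> r" "r \<le> N" for r
    using that(2,1) by (induction rule: inc_induct) (use Ssuc in auto)
  have S: "S r = S 0" if "r < N" for r
    using S2[of r] S01 that by (cases "r \<le> 1") (auto simp: le_Suc_eq)
  have "(\<Sum>r<N. S r) = (\<Sum>r<N. S 0)" by (rule sum.cong[OF refl], rule S) simp
  then have "N * S 0 = (\<Sum>r<N. S r)" by simp
  also have "\<dots> = (\<Sum>x\<in>Q. \<Sum>r<N. card (minima_mod x r))" unfolding S_def by (rule sum.swap)
  also have "\<dots> = (\<Sum>x\<in>Q. n - 1)" using sum_minima_mod sub by (intro sum.cong) auto
  finally have a: "N * S 0 = card Q * (n - 1)" by simp
  have "(\<Sum>x\<in>Q. card (down_arcs x)) + S 1 = (\<Sum>x\<in>Q. card (down_arcs x) + card (minima_mod x 1))"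
    unfolding S_def by (simp add: sum.distrib)
  also have "\<dots> = (\<Sum>x\<in>Q. n - 1)" using card_down_arcs sub by (intro sum.cong) auto
  finally have "(\<Sum>x\<in>Q. card (down_arcs x)) + S 0 = card Q * (n - 1)" using S01 by simp
  then have "N * (\<Sum>x\<in>Q. card (down_arcs x)) + card Q * (n - 1) = N * (card Q * (n - 1))"
    using a by (metis add_mult_distrib2)
  moreover have "N * (card Q * (n - 1)) = m * (card Q * (n - 1)) + card Q * (n - 1)"
    using N_eq by simp
  ultimately have "N * (\<Sum>x\<in>Q. card (down_arcs x)) = m * (card Q * (n - 1))" by linarith
  then show ?thesis by (simp only: ac_simps)
qed

section \<open>Transfer to the lattice\<close>

abbreviation L :: "int list gorder" where
  "L \<equiv> Tam m n"

lemma length_vec [simp]: "length (vec x) = N * n + 1"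
  unfolding vec_def by simp

lemma nth_vec [simp]: "i \<le> N * n \<Longrightarrow> vec x ! i = int (x i)"
  unfolding vec_def by (simp del: upt_Suc)

lemma vec_le_iff:
  assumes "x \<in> brackets" "y \<in> brackets"
  shows "list_all2 (\<le>) (vec x) (vec y) \<longleftrightarrow> x \<le> y"
proof -
  have "list_all2 (\<le>) (vec x) (vec y) \<longleftrightarrow> (\<forall>i\<le>N * n. x i \<le> y i)"
    by (auto simp: list_all2_conv_all_nth less_Suc_eq_le)
  also have "\<dots> \<longleftrightarrow> x \<le> y"
    using outside[OF assms(1)] outside[OF assms(2)] by (auto simp: le_fun_def) (metis linorder_not_le order_refl)
  finally show ?thesis .
qed

lemma vec_inj: "inj_on vec brackets"
  using vec_le_iff by (metis inj_onI order_antisym order_refl)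

text \<open>The lower bound \<open>s + 1\<close> for the positions \<open>N * s + t\<close> with
  \<open>t \<in> {1..N}\<close> is the inequality \<open>i \<le> N * x i\<close> read column by
  column.\<close>

lemma carrier_L: "carrier L = vec ` brackets"
proof -
  have "tamari_vectors m n = vec ` brackets"
  proof (intro equalityI subsetI)
    fix b assume "b \<in> vec ` brackets"
    then obtain x where x: "x \<in> brackets" and b: "b = vec x" by blast
    have column: "N * s + t \<le> N * n" "s + 1 \<le> x (N * s + t)" if "s < n" "t \<in> {1..N}" for s t
    proof -
      show *: "N * s + t \<le> N * n" using mult_less_step[OF that(1)] that(2) by simp
      show "s + 1 \<le> x (N * s + t)"
      proof (rule ccontr)
        assume "\<not> ?thesis"
        then have "N * x (N * s + t) \<le> N * s" by simp
        moreover have "1 \<le> t" using that(2) by simp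
        ultimately show False using le_mult[OF x *] by linarith
      qed
    qed
    have "b ! j \<le> b ! i" if "i \<le> N * n" "i + 1 \<le> j" "int j \<le> int N * b ! i" for i j
    proof -
      have j: "j \<le> N * x i" using that b by (metis nth_vec of_nat_le_iff of_nat_mult)
      then have "j \<le> N * n" using le_n[OF x, of i] by (meson le_trans mult_le_mono2)
      then show ?thesis using nested[OF x, of i j] that b j by simp
    qed
    moreover have "int s + 1 \<le> b ! (N * s + t)" "b ! (N * s + t) \<le> int n"
      if "s < n" "t \<in> {1..N}" for s t
      using column[OF that] le_n[OF x] b by auto
    moreover have "b ! (N * k) = int k" if "k \<le> n" for k
      using at_mult[OF x that] b that by simp
    ultimately show "b \<in> tamari_vectors m n"
      using b unfolding tamari_vectors_def N_eq[symmetric] by auto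
  next
    fix b assume "b \<in> tamari_vectors m n"
    then have b: "length b = N * n + 1" "\<And>k. k \<le> n \<Longrightarrow> b ! (N * k) = int k"
      "\<And>s t. s < n \<Longrightarrow> t \<in> {1..N} \<Longrightarrow> int s + 1 \<le> b ! (N * s + t)"
      "\<And>s t. s < n \<Longrightarrow> t \<in> {1..N} \<Longrightarrow> b ! (N * s + t) \<le> int n"
      "\<And>i j. i \<le> N * n \<Longrightarrow> i + 1 \<le> j \<Longrightarrow> int j \<le> int N * b ! i \<Longrightarrow> b ! j \<le> b ! i"
      unfolding tamari_vectors_def N_eq[symmetric] by auto
    define x where "x i = (if i \<le> N * n then nat (b ! i) else 0)" for i
    have bounds: "0 \<le> b ! i \<and> int i \<le> int N * b ! i \<and> b ! i \<le> int n" if "i \<le> N * n" for i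
    proof (cases i)
      case 0
      then show ?thesis using b(2)[of 0] by simp
    next
      case (Suc i')
      define s where "s = i' div N"
      \<comment> \<open>A column runs from \<open>N * s + 1\<close> to \<open>N * s + N\<close>, so
        the remainder is taken for \<open>i - 1\<close> and shifted by one.\<close>
      define t where "t = i' mod N + 1"
      have i: "i = N * s + t" unfolding s_def t_def using Suc by simp
      have t: "t \<in> {1..N}" using N_ge2 unfolding t_def by (simp add: Suc_leI)
      then have "1 \<le> t" by simp
      then have "N * s < N * n" using i that by linarith
      then have s: "s < n" by simp
      have "int i \<le> int N * (int s + 1)" using i t by (simp add: algebra_simps)
      also have "\<dots> \<le> int N * b ! i" using b(3)[OF s t] i by (intro mult_left_mono) auto
      finally show ?thesis using b(3,4)[OF s t] i by simp
    qed
    then have int_x: "int (x i) = b ! i" if "i \<le> N * n" for i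
      using that unfolding x_def by simp
    have "x \<in> brackets"
    proof (rule bracketsI)
      show "x (N * k) = k" if "k \<le> n" for k using b(2)[OF that] that unfolding x_def by simp
      show "i \<le> N * x i" if "i \<le> N * n" for i
        using bounds[OF that] int_x[OF that] by (metis of_nat_le_iff of_nat_mult)
      show "x i \<le> n" if "i \<le> N * n" for i
        using bounds[OF that] int_x[OF that] by (metis of_nat_le_iff)
      show "x i = 0" if "i > N * n" for i using that unfolding x_def by simp
      fix i j assume ij: "i < j" "j \<le> N * x i" "i \<le> N * n" "j \<le> N * n"
      have "int j \<le> int N * b ! i" using ij(2) int_x[OF ij(3)] by (metis of_nat_le_iff of_nat_mult)
      then have "b ! j \<le> b ! i" using b(5) ij by simp
      then show "x j \<le> x i" using int_x ij by (metis of_nat_le_iff)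
    qed
    moreover have "b = vec x" by (rule nth_equalityI) (use b(1) int_x in auto)
    ultimately show "b \<in> vec ` brackets" by blast
  qed
  then show ?thesis unfolding Tam_def by simp
qed

lemma le_L: "x \<in> brackets \<Longrightarrow> y \<in> brackets \<Longrightarrow> vec x \<sqsubseteq>\<^bsub>L\<^esub> vec y \<longleftrightarrow> x \<le> y"
  using vec_le_iff unfolding Tam_def by simp

lemma less_L: "x \<in> brackets \<Longrightarrow> y \<in> brackets \<Longrightarrow> vec x \<sqsubset>\<^bsub>L\<^esub> vec y \<longleftrightarrow> x < y"
  using le_L vec_inj unfolding lless_def by (auto simp: Tam_def less_le inj_on_def)

sublocale L: partial_order L
  by unfold_locales (auto simp: carrier_L le_L, auto simp: Tam_def inj_on_eq_iff[OF vec_inj])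

section \<open>Covers and down-degree in the Tamari lattice\<close>

lemma covers_vec: "x \<in> brackets \<Longrightarrow> y \<in> brackets \<Longrightarrow> vec x \<lessdot>\<^bsub>L\<^esub> vec y \<longleftrightarrow> covered x y"
  unfolding covers_def covered_def by (auto simp: carrier_L less_L)

lemma covers_iff:
  "a \<lessdot>\<^bsub>L\<^esub> b \<longleftrightarrow> (\<exists>y\<in>brackets. \<exists>p w. (p, w) \<in> down_arcs y \<and> a = vec (y(p := w)) \<and> b = vec y)"
proof
  assume c: "a \<lessdot>\<^bsub>L\<^esub> b"
  then obtain x y where x: "x \<in> brackets" "a = vec x" and y: "y \<in> brackets" "b = vec y"
    unfolding covers_def carrier_L by auto
  then have "covered x y" using c covers_vec by simp
  then obtain p w where "(p, w) \<in> down_arcs y" "x = y(p := w)"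
    unfolding covered_iff[OF y(1)] by blast
  then show "\<exists>y\<in>brackets. \<exists>p w. (p, w) \<in> down_arcs y \<and> a = vec (y(p := w)) \<and> b = vec y"
    using x(2) y by blast
next
  assume "\<exists>y\<in>brackets. \<exists>p w. (p, w) \<in> down_arcs y \<and> a = vec (y(p := w)) \<and> b = vec y"
  then show "a \<lessdot>\<^bsub>L\<^esub> b"
    using covers_vec covered_iff lower_in_brackets by blast
qed

lemma covers_vec_iff:
  "y \<in> brackets \<Longrightarrow> a \<lessdot>\<^bsub>L\<^esub> vec y \<longleftrightarrow> (\<exists>p w. (p, w) \<in> down_arcs y \<and> a = vec (y(p := w)))"
  unfolding covers_iff by (metis inj_onD[OF vec_inj])

text \<open>Different arcs give different lower covers, since a lowering determines the one position
  where it differs from \<open>y\<close>.\<close>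

lemma ddeg_vec:
  assumes y: "y \<in> brackets"
  shows "ddeg L (vec y) = card (down_arcs y)"
proof -
  have "{a. a \<lessdot>\<^bsub>L\<^esub> vec y} = (\<lambda>(p, w). vec (y(p := w))) ` down_arcs y"
    using covers_vec_iff[OF y] by auto
  moreover have "inj_on (\<lambda>(p, w). vec (y(p := w))) (down_arcs y)"
  proof (rule inj_onI; clarify)
    fix p w q u
    assume a: "(p, w) \<in> down_arcs y" "(q, u) \<in> down_arcs y" "vec (y(p := w)) = vec (y(q := u))"
    then have e: "y(p := w) = y(q := u)"
      using inj_onD[OF vec_inj] lower_in_brackets[OF y] by blast
    have "q = p"
      using down_arcD(5)[OF y a(1)] fun_cong[OF e, of p] by (auto split: if_splits)
    then show "p = q \<and> w = u" using down_arc_unique[OF y] a by blast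
  qed
  ultimately show ?thesis unfolding ddeg_def by (simp add: card_image)
qed

text \<open>A position within the reach of the minimum is within the reach of both entries, so
  nesting survives entrywise minima.\<close>

lemma meet_vec:
  assumes x: "x \<in> brackets" and y: "y \<in> brackets"
  shows "vec x \<sqinter>\<^bsub>L\<^esub> vec y = vec (\<lambda>i. min (x i) (y i))" "(\<lambda>i. min (x i) (y i)) \<in> brackets"
proof -
  let ?z = "\<lambda>i. min (x i) (y i)"
  show z: "?z \<in> brackets"
  proof (rule bracketsI)
    fix i j assume "i < j" "j \<le> N * ?z i"
    then show "?z j \<le> ?z i" using nested[OF x, of i j] nested[OF y, of i j]
      by (auto simp: min_def split: if_splits)
  qed (use at_mult[OF x] at_mult[OF y] le_mult[OF x] le_mult[OF y] le_n[OF x] le_n[OF y] outside[OF x]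
        in \<open>auto simp: min_def intro: order_trans\<close>)
  have "greatest L (vec ?z) (Lower L {vec x, vec y})"
    using x y z unfolding greatest_def Lower_def by (auto simp: carrier_L le_L le_fun_def)
  \<comment> \<open>The meet is a chosen greatest lower bound; uniqueness identifies the
    choice.\<close>
  then show "vec x \<sqinter>\<^bsub>L\<^esub> vec y = vec ?z"
    unfolding meet_def inf_def using L.greatest_unique by (metis (mono_tags, lifting) someI)
qed

section \<open>Join-irreducibles, kappa and cover labels\<close>

lemma covers_join_irr:
  assumes arc: "(p, w) \<in> arcs"
  shows "a \<lessdot>\<^bsub>L\<^esub> vec (join_irr p w) \<longleftrightarrow> a = vec ((join_irr p w)(p := w))"
proof -
  have "(q, u) \<in> down_arcs (join_irr p w) \<longleftrightarrow> q = p \<and> u = w" for q u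
    using down_arcs_join_irr[OF arc] by blast
  then show ?thesis using covers_vec_iff[OF join_irr_in_brackets[OF arc]] by metis
qed

text \<open>For an arc \<open>(p, w)\<close> of a join-irreducible \<open>y\<close>, the vector
  \<open>join_irr p w\<close> lies below \<open>y\<close>. If it were smaller, it would lie below
  the only lower cover \<open>y(p := w)\<close>, whose entry at \<open>p\<close> does not exceed
  \<open>w\<close>.\<close>

lemma join_irreducible_iff:
  "join_irreducible L j \<longleftrightarrow> (\<exists>p w. (p, w) \<in> arcs \<and> j = vec (join_irr p w))"
proof
  assume j: "join_irreducible L j"
  then obtain y where y: "y \<in> brackets" "j = vec y" unfolding join_irreducible_def carrier_L by blast
  have ex1: "\<exists>!a. a \<lessdot>\<^bsub>L\<^esub> vec y" using j y unfolding join_irreducible_def by simp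
  then obtain p w where pw: "(p, w) \<in> down_arcs y" using covers_vec_iff[OF y(1)] by blast
  then have arc: "(p, w) \<in> arcs" using down_arcs_subset[OF y(1)] by blast
  have le: "join_irr p w \<le> y" using join_irr_le_iff[OF arc y(1)] down_arcD(5)[OF y(1) pw] by simp
  have "join_irr p w = y"
  proof (rule ccontr)
    assume "join_irr p w \<noteq> y"
    then obtain q u where qu: "(q, u) \<in> down_arcs y" "join_irr p w \<le> y(q := u)"
      using below_some_lower[OF y(1) join_irr_in_brackets[OF arc] le] by blast
    have "vec (y(q := u)) = vec (y(p := w))"
      using ex1 covers_vec_iff[OF y(1)] qu(1) pw by blast
    then have "y(q := u) = y(p := w)"
      using inj_onD[OF vec_inj] lower_in_brackets[OF y(1)] qu(1) pw by blast
    then have "\<not> w < (y(q := u)) p" by simp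
    then show False using join_irr_le_iff[OF arc] qu lower_in_brackets[OF y(1)] by blast
  qed
  then show "\<exists>p w. (p, w) \<in> arcs \<and> j = vec (join_irr p w)" using arc y(2) by blast
next
  assume "\<exists>p w. (p, w) \<in> arcs \<and> j = vec (join_irr p w)"
  then obtain p w where arc: "(p, w) \<in> arcs" and j: "j = vec (join_irr p w)" by blast
  show "join_irreducible L j"
    unfolding join_irreducible_def j covers_join_irr[OF arc]
    using join_irr_in_brackets[OF arc] by (simp add: carrier_L)
qed

context
  fixes p w assumes arc: "(p, w) \<in> arcs"
begin

lemma lower_cover_join_irr: "lower_cover L (vec (join_irr p w)) = vec ((join_irr p w)(p := w))"
  unfolding lower_cover_def covers_join_irr[OF arc] by simp

text \<open>Away from \<open>p\<close>, \<open>kap p w\<close> dominates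
  \<open>join_irr p w\<close>, so their meet lowers only the entry at \<open>p\<close>. Any
  \<open>z\<close> with the same meet has \<open>z p = w\<close>, and nesting then bounds it by
  \<open>w\<close> up to \<open>N * w\<close>.\<close>

lemma kappa_join_irr: "kappa L (vec (join_irr p w)) = vec (kap p w)"
proof -
  let ?J = "join_irr p w" and ?K = "kap p w"
  let ?S = "{z \<in> carrier L. z \<sqinter>\<^bsub>L\<^esub> vec ?J = lower_cover L (vec ?J)}"
  note J = join_irr_in_brackets[OF arc]
  note K = kap_in_brackets[OF arc]
  note a = arcD[OF arc]
  have low: "?J(p := w) \<in> brackets"
    using lower_in_brackets[OF J] down_arcs_join_irr[OF arc] by blast
  have S: "vec z \<in> ?S \<longleftrightarrow> (\<lambda>i. min (z i) (?J i)) = ?J(p := w)" if "z \<in> brackets" for z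
    using meet_vec[OF that J] low lower_cover_join_irr inj_onD[OF vec_inj] that
    by (auto simp: carrier_L)
  have "?K p = w" using a unfolding kap_def by simp
  moreover have "?J i \<le> ?K i" if "i \<noteq> p" for i
  proof (cases "i \<le> N * n \<and> N * (p div N) < i \<and> i \<le> p")
    case True
    then have "\<not> N dvd i" using mult_not_in_column[OF arc] by auto
    then have "?K i = n" using True that unfolding kap_def by auto
    then show ?thesis using le_n[OF J] by simp
  next
    case False
    then show ?thesis using ceil_le[OF K] unfolding join_irr_def by auto
  qed
  ultimately have "min (?K i) (?J i) = (?J(p := w)) i" for i
    using join_irr_p[OF arc] by (cases "i = p") (simp_all add: min_absorb2)
  then have "(\<lambda>i. min (?K i) (?J i)) = ?J(p := w)" by blast
  then have "vec ?K \<in> ?S" using S[OF K] by blast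
  moreover have "vec z \<sqsubseteq>\<^bsub>L\<^esub> vec ?K" if z: "z \<in> brackets" "vec z \<in> ?S" for z
  proof -
    have "min (z p) (?J p) = w" using S[OF z(1)] z(2) by (metis fun_upd_same)
    then have zp: "z p = w" using join_irr_p[OF arc] by simp
    then have "\<forall>i. p \<le> i \<and> i \<le> N * w \<longrightarrow> z i \<le> w" using nested'[OF z(1), of p] by auto
    then show ?thesis using le_kap_iff[OF arc z(1)] le_L[OF z(1) K] by blast
  qed
  ultimately have "greatest L (vec ?K) ?S"
    unfolding greatest_def by (auto simp: carrier_L)
  then show ?thesis unfolding kappa_def using L.greatest_unique by blast
qed

end

text \<open>A label \<open>(q, u)\<close> needs \<open>?x q \<le> u < y q\<close>, which forces
  \<open>q = p\<close> and \<open>w \<le> u\<close>; maximality of \<open>w\<close> gives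
  \<open>u \<le> w\<close>.\<close>

lemma cover_label_vec:
  assumes y: "y \<in> brackets" and arc: "(p, w) \<in> down_arcs y"
  shows "cover_label L (vec (y(p := w))) (vec y) = vec (join_irr p w)"
proof -
  let ?x = "y(p := w)"
  note d = down_arcD[OF y arc]
  have x: "?x \<in> brackets" using lower_in_brackets[OF y arc] .
  have pw: "(p, w) \<in> arcs" using down_arcs_subset[OF y] arc by blast
  have iff: "vec (join_irr q u) \<sqsubseteq>\<^bsub>L\<^esub> vec y \<and> vec ?x \<sqsubseteq>\<^bsub>L\<^esub> kappa L (vec (join_irr q u))
      \<longleftrightarrow> u < y q \<and> (\<forall>i. q \<le> i \<and> i \<le> N * u \<longrightarrow> ?x i \<le> u)" if "(q, u) \<in> arcs" for q u
    using join_irr_le_iff[OF that y] le_kap_iff[OF that x] le_L[OF join_irr_in_brackets[OF that] y]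
      le_L[OF x kap_in_brackets[OF that]] kappa_join_irr[OF that] by simp
  show ?thesis unfolding cover_label_def
  proof (rule the_equality, intro conjI)
    show "join_irreducible L (vec (join_irr p w))" using join_irreducible_iff pw by blast
    have "u \<le> w" if "p \<le> i \<and> i \<le> N * w" "u = ?x i" for i u
      using that d(7)[of i] by (cases "i = p") auto
    then show "vec (join_irr p w) \<sqsubseteq>\<^bsub>L\<^esub> vec y" "vec ?x \<sqsubseteq>\<^bsub>L\<^esub> kappa L (vec (join_irr p w))"
      using iff[OF pw] d(5) by blast+
  next
    fix j
    assume j: "join_irreducible L j \<and> j \<sqsubseteq>\<^bsub>L\<^esub> vec y \<and> vec ?x \<sqsubseteq>\<^bsub>L\<^esub> kappa L j"
    then obtain q u where qu: "(q, u) \<in> arcs" "j = vec (join_irr q u)"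
      using join_irreducible_iff by blast
    then have lt: "u < y q" and le: "\<And>i. q \<le> i \<Longrightarrow> i \<le> N * u \<Longrightarrow> ?x i \<le> u"
      using iff[OF qu(1)] j by auto
    have "?x q \<le> u" using le[of q] arcD(2)[OF qu(1)] by simp
    then have q: "q = p" using lt by (auto split: if_splits)
    then have "w \<le> u" using \<open>?x q \<le> u\<close> by simp
    moreover have "y i \<le> u" if "p < i" "i \<le> N * u" for i
      using le[of i] that q by simp
    then have "u \<le> w" using down_arc_max[OF y arc] lt q by blast
    ultimately show "j = vec (join_irr p w)" using qu(2) q by simp
  qed
qed

section \<open>Label sets, rowmotion and its orbits\<close>

lemma down_labels_vec:
  assumes y: "y \<in> brackets"
  shows "down_labels L (vec y) = (\<lambda>(p, w). vec (join_irr p w)) ` down_arcs y"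
proof (intro equalityI subsetI)
  fix j assume "j \<in> down_labels L (vec y)"
  then obtain a where a: "a \<lessdot>\<^bsub>L\<^esub> vec y" "j = cover_label L a (vec y)"
    unfolding down_labels_def by blast
  then obtain p w where pw: "(p, w) \<in> down_arcs y" "a = vec (y(p := w))"
    unfolding covers_vec_iff[OF y] by blast
  then have "j = vec (join_irr p w)" using cover_label_vec[OF y pw(1)] a(2) by simp
  then show "j \<in> (\<lambda>(p, w). vec (join_irr p w)) ` down_arcs y" using pw(1) by force
next
  fix j assume "j \<in> (\<lambda>(p, w). vec (join_irr p w)) ` down_arcs y"
  then obtain p w where pw: "(p, w) \<in> down_arcs y" "j = vec (join_irr p w)" by auto
  then have "vec (y(p := w)) \<lessdot>\<^bsub>L\<^esub> vec y" unfolding covers_vec_iff[OF y] by blast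
  moreover have "j = cover_label L (vec (y(p := w))) (vec y)"
    using cover_label_vec[OF y pw(1)] pw(2) by simp
  ultimately show "j \<in> down_labels L (vec y)" unfolding down_labels_def by blast
qed

lemma up_labels_vec:
  assumes z: "z \<in> brackets"
  shows "up_labels L (vec z) = (\<lambda>(p, w). vec (join_irr p w)) ` up_arcs z"
proof (intro equalityI subsetI)
  fix j assume "j \<in> up_labels L (vec z)"
  then obtain b where b: "vec z \<lessdot>\<^bsub>L\<^esub> b" "j = cover_label L (vec z) b"
    unfolding up_labels_def by blast
  then obtain y p w where y: "y \<in> brackets" "(p, w) \<in> down_arcs y" "vec z = vec (y(p := w))" "b = vec y"
    unfolding covers_iff by blast
  have "z = y(p := w)" using inj_onD[OF vec_inj y(3) z] lower_in_brackets[OF y(1,2)] by blast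
  then have "(p, w) \<in> up_arcs z" using up_arcs_iff[OF z] y by blast
  moreover have "j = vec (join_irr p w)" using cover_label_vec[OF y(1,2)] b(2) y by simp
  ultimately show "j \<in> (\<lambda>(p, w). vec (join_irr p w)) ` up_arcs z" by force
next
  fix j assume "j \<in> (\<lambda>(p, w). vec (join_irr p w)) ` up_arcs z"
  then obtain p w where pw: "(p, w) \<in> up_arcs z" "j = vec (join_irr p w)" by auto
  then obtain y where y: "y \<in> brackets" "(p, w) \<in> down_arcs y" "z = y(p := w)"
    using up_arcs_iff[OF z] by blast
  then have "vec z \<lessdot>\<^bsub>L\<^esub> vec y" unfolding covers_iff by blast
  moreover have "j = cover_label L (vec z) (vec y)" using cover_label_vec[OF y(1,2)] y(3) pw(2) by simp
  ultimately show "j \<in> up_labels L (vec z)" unfolding up_labels_def by blast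
qed

lemma labels_eq_iff:
  assumes y: "y \<in> brackets" and x: "x \<in> brackets"
  shows "up_labels L (vec y) = down_labels L (vec x) \<longleftrightarrow> up_arcs y = down_arcs x"
proof -
  have inj: "inj_on (\<lambda>(p, w). vec (join_irr p w)) arcs"
  proof (rule inj_onI; clarify)
    fix p w q u
    assume a: "(p, w) \<in> arcs" "(q, u) \<in> arcs" "vec (join_irr p w) = vec (join_irr q u)"
    then have "join_irr p w = join_irr q u"
      using inj_onD[OF vec_inj] join_irr_in_brackets by blast
    then show "p = q \<and> w = u" using join_irr_inj a by blast
  qed
  have "up_arcs y \<subseteq> arcs" using up_arcD[OF y] unfolding arcs_def by auto
  then show ?thesis
    unfolding up_labels_vec[OF y] down_labels_vec[OF x]
    using inj_on_image_eq_iff[OF inj] down_arcs_subset[OF x] by blast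
qed

text \<open>\<open>up_arcs_rowm\<close> supplies existence and \<open>up_arcs_inj\<close> uniqueness
  for the definite description of \<open>row\<close>.\<close>

lemma row_vec:
  assumes x: "x \<in> brackets"
  shows "row L (vec x) = vec (rowm x)"
  unfolding row_def
proof (rule the_equality)
  show "vec (rowm x) \<in> carrier L \<and> up_labels L (vec (rowm x)) = down_labels L (vec x)"
    using labels_eq_iff[OF rowm_in_brackets[OF x] x] up_arcs_rowm[OF x] rowm_in_brackets[OF x]
    by (simp add: carrier_L)
next
  fix b assume b: "b \<in> carrier L \<and> up_labels L b = down_labels L (vec x)"
  then obtain y where y: "y \<in> brackets" "b = vec y" unfolding carrier_L by blast
  then have "up_arcs y = up_arcs (rowm x)"
    using labels_eq_iff[OF y(1) x] b up_arcs_rowm[OF x] by simp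
  then show "b = vec (rowm x)" using up_arcs_inj y rowm_in_brackets[OF x] by blast
qed

text \<open>\<open>vec\<close> intertwines \<open>rowm\<close> with \<open>row L\<close>, so it
  carries orbits to orbits.\<close>

lemma orbit_row_vec:
  assumes x: "x \<in> brackets"
  shows "orbit (row L) (vec x) = vec ` orbit rowm x" "orbit rowm x \<subseteq> brackets"
proof -
  show sub: "orbit rowm x \<subseteq> brackets"
  proof
    fix y assume "y \<in> orbit rowm x"
    then show "y \<in> brackets" by induction (use x rowm_in_brackets in auto)
  qed
  show "orbit (row L) (vec x) = vec ` orbit rowm x"
  proof (intro equalityI subsetI)
    fix b assume "b \<in> orbit (row L) (vec x)"
    then show "b \<in> vec ` orbit rowm x"
    proof induction
      case base
      show ?case using row_vec[OF x] imageI[OF orbit.base[of rowm x], of vec] by simp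
    next
      case (step b)
      then obtain y where y: "y \<in> orbit rowm x" "b = vec y" by blast
      then have "row L b = vec (rowm y)" using row_vec[of y] sub by auto
      then show ?case using imageI[OF orbit.step[OF y(1)], of vec] by simp
    qed
  next
    fix b assume "b \<in> vec ` orbit rowm x"
    then obtain y where "y \<in> orbit rowm x" "b = vec y" by blast
    then show "b \<in> orbit (row L) (vec x)"
    proof (induction arbitrary: b)
      case base
      then show ?case using row_vec[OF x] orbit.base[of "row L" "vec x"] by simp
    next
      case (step y)
      then have "row L (vec y) = vec (rowm y)" using row_vec[of y] sub by auto
      then show ?case
        using orbit.step[of "vec y" "row L" "vec x"] step.IH[of "vec y"] step.prems by simp
    qed
  qed
qed

lemma finite_brackets: "finite brackets"
proof -
  have "finite {b. set b \<subseteq> {0..int n} \<and> length b = N * n + 1}"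
    by (rule finite_lists_length_eq) simp
  moreover have "vec ` brackets \<subseteq> {b. set b \<subseteq> {0..int n} \<and> length b = N * n + 1}"
    using le_n by (auto simp: vec_def)
  ultimately show ?thesis using finite_imageD[OF _ vec_inj] finite_subset by blast
qed

lemma homomesic_ddeg:
  "homomesic (carrier L) (row L) (\<lambda>b. real (ddeg L b)) (real m * (real n - 1) / (real m + 1))"
  unfolding homomesic_def
proof
  fix Orb assume "Orb \<in> orbit (row L) ` carrier L"
  then obtain x where x: "x \<in> brackets" and Orb: "Orb = orbit (row L) (vec x)"
    unfolding carrier_L by blast
  define Q where "Q = orbit rowm x"
  have Q: "Orb = vec ` Q" "Q \<subseteq> brackets" using orbit_row_vec[OF x] Orb Q_def by auto
  have fin: "finite Q" using finite_subset[OF Q(2) finite_brackets] .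
  have "rowm ` Q \<subseteq> Q" unfolding Q_def using orbit.step by auto
  then have "N * (\<Sum>y\<in>Q. card (down_arcs y)) = m * (n - 1) * card Q"
    using sum_card_down_arcs[OF Q(2) fin] by blast
  then have "real N * real (\<Sum>y\<in>Q. card (down_arcs y)) = real m * real (n - 1) * real (card Q)"
    by (metis of_nat_mult)
  moreover have inj: "inj_on vec Q" using vec_inj Q(2) inj_on_subset by blast
  have "(\<Sum>b\<in>Orb. real (ddeg L b)) = (\<Sum>y\<in>Q. real (card (down_arcs y)))"
    unfolding Q(1) sum.reindex[OF inj] using ddeg_vec Q(2) by (intro sum.cong) auto
  moreover have "card Orb = card Q" unfolding Q(1) using card_image[OF inj] .
  \<comment> \<open>The orbit is nonempty, so dividing by its size is legitimate.\<close>
  moreover have "card Q \<noteq> 0" using fin orbit.base[of rowm x] unfolding Q_def by auto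
  ultimately show "1 / real (card Orb) * (\<Sum>b\<in>Orb. real (ddeg L b))
      = real m * (real n - 1) / (real m + 1)"
    using n_pos N_eq by (simp add: field_simps of_nat_diff)
qed

end

theorem theorem5p14:
  fixes m n :: nat
  assumes "m \<ge> 1" and "n \<ge> 1"
  shows "homomesic (carrier (Tam m n)) (row (Tam m n)) (\<lambda>b. real (ddeg (Tam m n) b))
           (real m * (real n - 1) / (real m + 1))"
proof -
  interpret m_tamari m n "m + 1"
    using assms by unfold_locales auto
  show ?thesis by (rule homomesic_ddeg)
qed

end
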